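(* Let $F$ be a face (cycle) of a plane graph, $D$ a multiset of demand edges (each of demand $1$) with endpoints on $F$, and $S\subseteq F$ a contiguous segment such that every $uv\in D$ satisfies $|\{u,v\}\cap S|=1$. Then there exist laminar demand multisets $L_1,L_2$ on $F$ such that $L_1\le D$, $L_2\le 2D$, and $L_1+L_2\ge D$. Moreover, $L_1$ and $L_2$ can be found in polynomial time.
   Context: A contiguous segment of $F$ is a set of vertices forming a contiguous interval along the cycle $F$. For a demand multiset $H$ on $F$ and segment $S$, $\delta_H(S)$ is the number of edges of $H$ with exactly one endpoint in $S$. $H\ge H'$ (equivalently $H'\le H$) means $\delta_H(S)\ge\delta_{H'}(S)$ for every contiguous segment $S$ of $F$. $2D$ is $D$ with each edge repeated twice; $L_1+L_2$ is the multiset union. Two demand edges $uv,xy$ cross if $u,x,v,y$ appear in this cyclic order on $F$; a demand multiset is laminar if no two of its edges cross. *)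

theory Defs
  imports
    "HOL-Analysis.Analysis"
    "HOL-Library.Multiset"
    "HOL-Library.Sublist"
    "HOL-Computational_Algebra.Polynomial"
begin

section \<open>Plane graphs and facial cycles\<close>

text \<open>
  A plane graph is a pair \<open>(V, E)\<close> of finitely many points of the plane and finitely many
  edges, an edge being the point set traced by a simple path that meets \<open>V\<close> exactly in its ends.
  Parallel edges and loops are allowed.
\<close>

type_synonym plane_graph = "complex set \<times> complex set set"

definition plane_graph :: "plane_graph \<Rightarrow> bool" where
  "plane_graph G \<longleftrightarrow> (case G of (V, E) \<Rightarrow>
     finite V \<and> finite E \<and>
     (\<forall>e\<in>E. \<exists>g. simple_path g \<and> path_image g = e \<and> e \<inter> V = {pathstart g, pathfinish g}) \<and>
     (\<forall>e\<in>E. \<forall>f\<in>E. e \<noteq> f \<longrightarrow> e \<inter> f \<subseteq> V))"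

definition faces :: "plane_graph \<Rightarrow> complex set set" where
  "faces G = components (- (fst G \<union> \<Union> (snd G)))"

text \<open>
  \<open>F\<close> lists the vertices of a cycle of \<open>G\<close> in cyclic order, and this cycle is the boundary of a
  face. The requirement that \<open>es\<close> be distinct matters only for cycles of length two, which consist
  of two parallel edges.
\<close>

definition facial_cycle :: "plane_graph \<Rightarrow> complex list \<Rightarrow> bool" where
  "facial_cycle G F \<longleftrightarrow>
     F \<noteq> [] \<and> distinct F \<and>
     (\<exists>C\<in>faces G. \<exists>es. length es = length F \<and> distinct es \<and> set es \<subseteq> snd G \<and>
        (\<forall>i<length F. es ! i \<inter> fst G = {F ! i, F ! (Suc i mod length F)}) \<and>
        frontier C = \<Union> (set es))"


section \<open>Demand multisets on a cycle\<close>

text \<open>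
  In this section \<open>F\<close> is the list of the vertices of a cycle in cyclic order. Demand edges are
  two-element vertex sets.
\<close>

definition demands_on :: "'v list \<Rightarrow> 'v set multiset \<Rightarrow> bool" where
  "demands_on F H \<longleftrightarrow> (\<forall>e\<in>#H. e \<subseteq> set F \<and> card e = 2)"

definition contiguous_segment :: "'v list \<Rightarrow> 'v set \<Rightarrow> bool" where
  "contiguous_segment F S \<longleftrightarrow> (\<exists>m k. S = set (take k (rotate m F)))"

definition cut_size :: "'v set multiset \<Rightarrow> 'v set \<Rightarrow> nat" where
  "cut_size H S = size {#e \<in># H. card (e \<inter> S) = 1#}"

definition dominated_by :: "'v list \<Rightarrow> 'v set multiset \<Rightarrow> 'v set multiset \<Rightarrow> bool" where
  "dominated_by F H' H \<longleftrightarrow> (\<forall>S. contiguous_segment F S \<longrightarrow> cut_size H' S \<le> cut_size H S)"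

definition crossing :: "'v list \<Rightarrow> 'v set \<Rightarrow> 'v set \<Rightarrow> bool" where
  "crossing F e f \<longleftrightarrow>
     (\<exists>u v x y. e = {u, v} \<and> f = {x, y} \<and> (\<exists>m. subseq [u, x, v, y] (rotate m F)))"

definition laminar_demands :: "'v list \<Rightarrow> 'v set multiset \<Rightarrow> bool" where
  "laminar_demands F L \<longleftrightarrow> demands_on F L \<and> (\<forall>e\<in>#L. \<forall>f\<in>#L. \<not> crossing F e f)"

definition laminar_cover ::
    "'v list \<Rightarrow> 'v set multiset \<Rightarrow> 'v set multiset \<Rightarrow> 'v set multiset \<Rightarrow> bool" where
  "laminar_cover F D L1 L2 \<longleftrightarrow>
     laminar_demands F L1 \<and> laminar_demands F L2 \<and>
     dominated_by F L1 D \<and> dominated_by F L2 (repeat_mset 2 D) \<and> dominated_by F D (L1 + L2)"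

definition segment_instance ::
    "plane_graph \<Rightarrow> complex list \<Rightarrow> complex set multiset \<Rightarrow> complex set \<Rightarrow> bool" where
  "segment_instance G F D S \<longleftrightarrow>
     plane_graph G \<and> facial_cycle G F \<and> demands_on F D \<and> contiguous_segment F S \<and>
     (\<forall>e\<in>#D. card (e \<inter> S) = 1)"


section \<open>Running time\<close>

text \<open>
  The machine model consists of first-order recursive programs over binary trees (as in Jones,
  \<^emph>\<open>Computability and Complexity\<close>): values are built from the empty tree by pairing, the only
  operations are pairing, the two projections, the test for emptiness and calls of the program's
  own functions, and each operation costs one step. There is no test for equality and no
  arithmetic. Values can be kept as shared pointers, so this model and Turing machines simulate
  each other with polynomial overhead. As sharing may make a tree larger than the time spent on
  building it, the size of the result has to be bounded along with the number of steps.
\<close>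

datatype btree = Leaf | Node btree btree

datatype expr =
    Arg nat
  | Empty
  | Pairing expr expr
  | Left expr
  | Right expr
  | Cond expr expr expr
  | Call nat "expr list"

type_synonym prog = "expr list"

fun left_of :: "btree \<Rightarrow> btree" where
  "left_of Leaf = Leaf"
| "left_of (Node a b) = a"

fun right_of :: "btree \<Rightarrow> btree" where
  "right_of Leaf = Leaf"
| "right_of (Node a b) = b"

text \<open>
  \<open>eval P vs e b t\<close>: under the program \<open>P\<close> (the list of the function bodies) and the arguments
  \<open>vs\<close> of the current call, the expression \<open>e\<close> evaluates to \<open>b\<close> in \<open>t\<close> steps.
\<close>

inductive eval :: "prog \<Rightarrow> btree list \<Rightarrow> expr \<Rightarrow> btree \<Rightarrow> nat \<Rightarrow> bool"
  and evals :: "prog \<Rightarrow> btree list \<Rightarrow> expr list \<Rightarrow> btree list \<Rightarrow> nat \<Rightarrow> bool"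
  for P :: prog
where
  Arg: "i < length vs \<Longrightarrow> eval P vs (Arg i) (vs ! i) 1"
| Empty: "eval P vs Empty Leaf 1"
| Pairing: "eval P vs e1 a s \<Longrightarrow> eval P vs e2 b t \<Longrightarrow>
    eval P vs (Pairing e1 e2) (Node a b) (s + t + 1)"
| Left: "eval P vs e a s \<Longrightarrow> eval P vs (Left e) (left_of a) (s + 1)"
| Right: "eval P vs e a s \<Longrightarrow> eval P vs (Right e) (right_of a) (s + 1)"
| Cond_Node: "eval P vs e a s \<Longrightarrow> a \<noteq> Leaf \<Longrightarrow> eval P vs e1 b t \<Longrightarrow>
    eval P vs (Cond e e1 e2) b (s + t + 1)"
| Cond_Leaf: "eval P vs e Leaf s \<Longrightarrow> eval P vs e2 b t \<Longrightarrow>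
    eval P vs (Cond e e1 e2) b (s + t + 1)"
| Call: "f < length P \<Longrightarrow> evals P vs es ws s \<Longrightarrow> eval P ws (P ! f) b t \<Longrightarrow>
    eval P vs (Call f es) b (s + t + 1)"
| evals_Nil: "evals P vs [] [] 0"
| evals_Cons: "eval P vs e a s \<Longrightarrow> evals P vs es as t \<Longrightarrow> evals P vs (e # es) (a # as) (s + t)"

lemma eval_deterministic:
  "eval P vs e b t \<Longrightarrow> eval P vs e b' t' \<Longrightarrow> b = b' \<and> t = t'"
  "evals P vs es bs t \<Longrightarrow> evals P vs es bs' t' \<Longrightarrow> bs = bs' \<and> t = t'"
proof (induction arbitrary: b' t' and bs' t' rule: eval_evals.inducts)
  case (Arg i vs)
  then show ?case by (auto elim: eval.cases)
next
  case (Empty vs)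
  then show ?case by (auto elim: eval.cases)
next
  case (Pairing vs e1 a s e2 b t)
  from Pairing.prems show ?case by cases (use Pairing.IH in blast)+
next
  case (Left vs e a s)
  from Left.prems show ?case by cases (use Left.IH in blast)+
next
  case (Right vs e a s)
  from Right.prems show ?case by cases (use Right.IH in blast)+
next
  case (Cond_Node vs e a s e1 b t e2)
  from Cond_Node.prems show ?case by cases (use Cond_Node.IH Cond_Node.hyps in blast)+
next
  case (Cond_Leaf vs e s e2 b t e1)
  from Cond_Leaf.prems show ?case by cases (use Cond_Leaf.IH in blast)+
next
  case (Call f vs es ws s b t)
  from Call.prems show ?case by cases (use Call.IH in blast)+
next
  case (evals_Nil vs)
  then show ?case by (auto elim: evals.cases)
next
  case (evals_Cons vs e a s es as t)
  from evals_Cons.prems show ?case by cases (use evals_Cons.IH in blast)+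
qed

definition runs :: "prog \<Rightarrow> btree \<Rightarrow> btree \<Rightarrow> nat \<Rightarrow> bool" where
  "runs P a b t \<longleftrightarrow> eval P [a] (Call 0 [Arg 0]) b t"


section \<open>Encoding of instances and results\<close>

text \<open>
  Vertices of the cycle are named by their positions in \<open>F\<close>. Numbers are written in unary; none
  of them exceeds the length of the cycle, which is itself part of the input size.
\<close>

fun enc_nat :: "nat \<Rightarrow> btree" where
  "enc_nat 0 = Leaf"
| "enc_nat (Suc n) = Node Leaf (enc_nat n)"

fun enc_edges :: "(nat \<times> nat) list \<Rightarrow> btree" where
  "enc_edges [] = Leaf"
| "enc_edges ((i, j) # es) = Node (Node (enc_nat i) (enc_nat j)) (enc_edges es)"

definition lists_demands :: "'v list \<Rightarrow> (nat \<times> nat) list \<Rightarrow> 'v set multiset \<Rightarrow> bool" where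
  "lists_demands F es H \<longleftrightarrow>
     (\<forall>(i, j)\<in>set es. i < length F \<and> j < length F) \<and>
     H = mset (map (\<lambda>(i, j). {F ! i, F ! j}) es)"

text \<open>
  The input consists of the length of the cycle, the first position and the number of vertices of
  the segment, and the demand edges in any order and orientation.
\<close>

definition encodes_input :: "'v list \<Rightarrow> 'v set multiset \<Rightarrow> 'v set \<Rightarrow> btree \<Rightarrow> bool" where
  "encodes_input F D S a \<longleftrightarrow>
     (\<exists>m k es. m < length F \<and> k \<le> length F \<and> S = set (take k (rotate m F)) \<and>
        lists_demands F es D \<and>
        a = Node (enc_nat (length F)) (Node (Node (enc_nat m) (enc_nat k)) (enc_edges es)))"

definition encodes_output :: "'v list \<Rightarrow> 'v set multiset \<Rightarrow> 'v set multiset \<Rightarrow> btree \<Rightarrow> bool" where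
  "encodes_output F L1 L2 b \<longleftrightarrow>
     (\<exists>es1 es2. lists_demands F es1 L1 \<and> lists_demands F es2 L2 \<and>
        b = Node (enc_edges es1) (enc_edges es2))"

end

theory Submission imports Defs begin

text \<open>
  Read the cycle from the first vertex of \<open>S\<close> on, so that \<open>S\<close> is a prefix and its complement \<open>T\<close>
  a suffix of a line; up to complements, the contiguous segments are the intervals. A height \<open>h\<close> on
  the suffixes of the line that vanishes at both ends yields a laminar matching: push each unit of
  ascent on a stack, and at each unit of descent match the top of the stack. If the line is
  \<open>us @ vs @ ws\<close>, then the cut of the matching on \<open>vs\<close> is \<open>h(vs @ ws) + h(ws) - 2 * h(xs @ ws)\<close>,
  where the suffix \<open>xs\<close> of \<open>vs\<close> minimises \<open>h(xs @ ws)\<close>, the number of arcs jumping over \<open>vs\<close>.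

  \<open>L1\<close> has the height \<open>\<delta>\<close>, the cut of \<open>D\<close>. It rises on \<open>S\<close> and falls on \<open>T\<close>, so the cut of \<open>L1\<close> on
  \<open>vs\<close> is \<open>\<bar>\<delta>(vs @ ws) - \<delta>(ws)\<bar> \<le> \<delta>(vs)\<close>, with equality if \<open>vs\<close> lies inside \<open>S\<close> or \<open>T\<close>. Otherwise
  \<open>vs = ps @ qs\<close> with a suffix \<open>ps\<close> of \<open>S\<close> and a prefix \<open>qs\<close> of \<open>T\<close>. Let \<open>x\<close> be the number of
  demands from \<open>S - ps\<close> to \<open>qs\<close>, and \<open>y\<close> the number of those from \<open>ps\<close> to \<open>T - qs\<close>. Then \<open>D\<close> has cut
  \<open>x + y\<close> and \<open>L1\<close> only \<open>\<bar>x - y\<bar>\<close>, so \<open>L2\<close> has to contribute at least \<open>2 * min x y\<close> and at most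
  \<open>2 * (x + y)\<close>.

  \<open>L2\<close> consists of two copies of the matching inside \<open>S\<close> with height \<open>h(ps) = min \<delta>(ps @ qs)\<close>, where
  \<open>qs\<close> ranges over the prefixes of \<open>T\<close>. Its cut on \<open>ps @ qs\<close> is \<open>2 * h(ps)\<close>, and
  \<open>min x y \<le> h(ps) \<le> x + y\<close> because \<open>x\<close> increases and \<open>y\<close> decreases with \<open>qs\<close>. On intervals inside
  \<open>S\<close> it is at most \<open>2 * \<delta>\<close> because adding or removing vertices changes \<open>h\<close> by at most the cut of
  \<open>D\<close> on the set of these vertices.
\<close>

section \<open>Matchings of height functions\<close>

definition cut_count :: "('v \<times> 'v) list \<Rightarrow> 'v set \<Rightarrow> 'v set \<Rightarrow> nat" where
  "cut_count es X Y = length (filter (\<lambda>(a, b). (a \<in> X) \<noteq> (b \<in> Y)) es)"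

lemma cut_count_simps [simp]:
  "cut_count [] X Y = 0"
  "cut_count ((a, b) # es) X Y = of_bool ((a \<in> X) \<noteq> (b \<in> Y)) + cut_count es X Y"
  "cut_count (es @ es') X Y = cut_count es X Y + cut_count es' X Y"
  by (simp_all add: cut_count_def)

lemma cut_count_cong:
  assumes "\<And>a b. (a, b) \<in> set es \<Longrightarrow> (a \<in> X) = (b \<in> Y) \<longleftrightarrow> (a \<in> X') = (b \<in> Y')"
  shows "cut_count es X Y = cut_count es X' Y'"
  unfolding cut_count_def using assms by (intro arg_cong[where f = length] filter_cong) auto

lemma cut_count_map_Pair:
  "cut_count (map (\<lambda>q. (q, v)) qs) X Y = length (filter (\<lambda>q. (q \<in> X) \<noteq> (v \<in> Y)) qs)"
  by (induction qs) auto

text \<open>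
  The height is a function of the remaining part of the line; it equals the number of arcs that are
  open in front of that part. The stack \<open>st\<close> holds the left ends of these arcs. Since subtraction
  is truncated, a vertex either closes or opens arcs.
\<close>

fun height_matching :: "('v list \<Rightarrow> nat) \<Rightarrow> 'v list \<Rightarrow> 'v list \<Rightarrow> ('v \<times> 'v) list" where
  "height_matching h [] st = []"
| "height_matching h (v # vs) st =
     map (\<lambda>q. (q, v)) (take (h (v # vs) - h vs) st) @
     height_matching h vs (replicate (h vs - h (v # vs)) v @ drop (h (v # vs) - h vs) st)"

lemma height_matching_ends:
  "set (height_matching h vs st) \<subseteq> (set st \<union> set vs) \<times> set vs"
  by (induction h vs st rule: height_matching.induct)
    (auto dest!: in_set_takeD in_set_dropD split: if_splits)

lemma length_height_matching:
  assumes "\<And>vs. h vs \<le> c"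
  shows "length (height_matching h vs st) \<le> length vs * c"
  using assms
proof (induction h vs st rule: height_matching.induct)
  case (2 h v vs st)
  have "length (take (h (v # vs) - h vs) st) \<le> c"
    using "2.prems"[of "v # vs"] by simp
  with "2.IH"[OF "2.prems"] show ?case by simp
qed simp

lemma height_matching_append:
  assumes "length st = h (us @ vs)"
  obtains es st' where "height_matching h (us @ vs) st = es @ height_matching h vs st'"
    and "length st' = h vs" and "set st' \<subseteq> set st \<union> set us"
    and "set es \<subseteq> (set st \<union> set us) \<times> set us"
  using assms
proof (induction us arbitrary: st thesis)
  case Nil
  then show ?case by (metis Un_upper1 append_Nil empty_set empty_subsetI)
next
  case (Cons u us)
  let ?st = "replicate (h (us @ vs) - h (u # us @ vs)) u @
    drop (h (u # us @ vs) - h (us @ vs)) st"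
  let ?es = "map (\<lambda>q. (q, u)) (take (h (u # us @ vs) - h (us @ vs)) st)"
  have "length ?st = h (us @ vs)" using Cons.prems by simp
  then obtain es st' where IH: "height_matching h (us @ vs) ?st = es @ height_matching h vs st'"
    "length st' = h vs" "set st' \<subseteq> set ?st \<union> set us" "set es \<subseteq> (set ?st \<union> set us) \<times> set us"
    using Cons.IH by blast
  show ?case
  proof (rule Cons.prems(1))
    show "height_matching h ((u # us) @ vs) st = (?es @ es) @ height_matching h vs st'"
      using IH(1) by simp
    have "set ?st \<subseteq> insert u (set st)"
      by (auto dest: in_set_dropD split: if_splits)
    moreover have "set ?es \<subseteq> set st \<times> {u}"
      by (auto dest: in_set_takeD)
    ultimately show "set st' \<subseteq> set st \<union> set (u # us)"
      and "set (?es @ es) \<subseteq> (set st \<union> set (u # us)) \<times> set (u # us)"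
      using IH(3,4) unfolding set_append list.set(2) by blast+
  qed (rule IH(2))
qed

lemma cut_count_height_matching_disjoint:
  assumes "h [] = 0" "length st = h vs" "set vs \<inter> X = {}"
  shows "cut_count (height_matching h vs st) X X = length (filter (\<lambda>q. q \<in> X) st)"
  using assms(2,3)
proof (induction vs arbitrary: st)
  case (Cons v vs)
  let ?d = "h (v # vs) - h vs"
  have "length (filter (\<lambda>q. q \<in> X) st) =
      length (filter (\<lambda>q. q \<in> X) (take ?d st)) + length (filter (\<lambda>q. q \<in> X) (drop ?d st))"
    by (metis append_take_drop_id filter_append length_append)
  with Cons show ?case by (simp add: cut_count_map_Pair)
qed (use assms(1) in simp)

lemma cut_count_height_matching_Cons:
  assumes "v \<in> X" "set st \<subseteq> X" "set st' \<inter> X = {}" "length (st @ st') = h (v # vs)"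
  defines "d \<equiv> h (v # vs) - h vs"
  shows "cut_count (height_matching h (v # vs) (st @ st')) X X = d - length st +
    cut_count (height_matching h vs
      ((replicate (h vs - h (v # vs)) v @ drop d st) @ drop (d - length st) st')) X X"
proof -
  have "filter (\<lambda>q. q \<notin> X) (take d st) = []"
    "filter (\<lambda>q. q \<notin> X) (take (d - length st) st') = take (d - length st) st'"
    using assms(2,3) by (auto simp: filter_id_conv filter_empty_conv dest!: in_set_takeD)
  with assms(1,4) show ?thesis by (auto simp: cut_count_map_Pair d_def)
qed

text \<open>
  The stack consists of left ends inside \<open>X\<close> above left ends outside. On \<open>vs\<close> the latter shrink to
  the least height; this much of the stack is left to the arcs jumping over \<open>X\<close>.
\<close>

lemma cut_count_height_matching_append:
  assumes "h [] = 0" "length (st @ st') = h (vs @ ws)"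
    and "set st \<subseteq> X" "set st' \<inter> X = {}" "set vs \<subseteq> X" "set ws \<inter> X = {}"
  shows "\<exists>m \<le> length st'. m \<le> h ws \<and>
    cut_count (height_matching h (vs @ ws) (st @ st')) X X + 2 * m = length st' + h ws \<and>
    (m = length st' \<or> (\<exists>us. suffix us vs \<and> h (us @ ws) = m))"
  using assms(2-5)
proof (induction vs arbitrary: st st')
  case Nil
  have "filter (\<lambda>q. q \<in> X) st = st" "filter (\<lambda>q. q \<in> X) st' = []"
    using Nil.prems by (auto simp: filter_id_conv filter_empty_conv)
  then show ?case
    using cut_count_height_matching_disjoint[of h "st @ st'" ws X] assms(1,6) Nil.prems by auto
next
  case (Cons v vs)
  let ?d = "h (v # vs @ ws) - h (vs @ ws)" and ?e = "h (vs @ ws) - h (v # vs @ ws)"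
  let ?st = "replicate ?e v @ drop ?d st" and ?st' = "drop (?d - length st) st'"
  have len: "length (?st @ ?st') = h (vs @ ws)" using Cons.prems by auto
  have cut: "cut_count (height_matching h ((v # vs) @ ws) (st @ st')) X X =
      ?d - length st + cut_count (height_matching h (vs @ ws) (?st @ ?st')) X X"
    using cut_count_height_matching_Cons[of v X st st' h "vs @ ws"] Cons.prems by simp
  have "set ?st \<subseteq> X" "set ?st' \<inter> X = {}"
    using Cons.prems by (auto dest: in_set_dropD split: if_splits)
  then obtain m where m: "m \<le> length ?st'" "m \<le> h ws"
    "cut_count (height_matching h (vs @ ws) (?st @ ?st')) X X + 2 * m = length ?st' + h ws"
    "m = length ?st' \<or> (\<exists>us. suffix us vs \<and> h (us @ ws) = m)"
    using Cons.IH[OF len] Cons.prems(4) by auto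
  have "m = length st' \<or> (\<exists>us. suffix us (v # vs) \<and> h (us @ ws) = m)"
  proof (cases "?d \<le> length st")
    case True
    then show ?thesis using m(4) by (auto intro: suffix_ConsI)
  next
    case False
    then have "length ?st' = h (vs @ ws)" using len by auto
    then show ?thesis using m(4) by (auto intro: suffix_ConsI)
  qed
  moreover have "cut_count (height_matching h ((v # vs) @ ws) (st @ st')) X X + 2 * m =
      length st' + h ws"
    using m(1,3) cut Cons.prems(1) by (simp only: length_drop length_append append_Cons) linarith
  moreover have "m \<le> length st'" using m(1) by simp
  ultimately show ?case using m(2) by blast
qed

lemma cut_count_height_matching_interval:
  assumes "h [] = 0" "h (us @ vs @ ws) = 0" "distinct (us @ vs @ ws)"
  obtains xs where "suffix xs vs" "h (xs @ ws) \<le> h (vs @ ws)" "h (xs @ ws) \<le> h ws"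
    "cut_count (height_matching h (us @ vs @ ws) []) (set vs) (set vs) + 2 * h (xs @ ws) =
      h (vs @ ws) + h ws"
proof -
  obtain es st
    where split: "height_matching h (us @ vs @ ws) [] = es @ height_matching h (vs @ ws) st"
    and st: "length st = h (vs @ ws)" "set st \<subseteq> set us" and es: "set es \<subseteq> set us \<times> set us"
    using assms(2) by (metis height_matching_append list.size(3) list.set(1) sup_bot_left)
  have "cut_count es (set vs) (set vs) = 0"
    using es assms(3) by (auto simp: cut_count_def filter_empty_conv)
  moreover obtain m where "m \<le> h (vs @ ws)" "m \<le> h ws"
    "cut_count (height_matching h (vs @ ws) st) (set vs) (set vs) + 2 * m = h (vs @ ws) + h ws"
    "m = h (vs @ ws) \<or> (\<exists>xs. suffix xs vs \<and> h (xs @ ws) = m)"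
    using cut_count_height_matching_append[of h "[]" st vs ws "set vs"] assms(1,3) st by auto
  ultimately show ?thesis using that split by auto
qed

definition noncrossing_arcs :: "('v \<Rightarrow> nat) \<Rightarrow> ('v \<times> 'v) list \<Rightarrow> bool" where
  "noncrossing_arcs pos es \<longleftrightarrow>
     (\<forall>(a, b)\<in>set es. pos a < pos b) \<and>
     (\<forall>(a, c)\<in>set es. \<forall>(b, d)\<in>set es. \<not> (pos a < pos b \<and> pos b < pos c \<and> pos c < pos d))"

lemma noncrossing_height_matching:
  assumes "sorted_wrt (\<lambda>x y. pos x < pos y) vs" "sorted_wrt (\<lambda>x y. pos y \<le> pos x) st"
    and "\<forall>q\<in>set st. \<forall>v\<in>set vs. pos q < pos v"
  shows "noncrossing_arcs pos (height_matching h vs st)"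
  using assms
proof (induction h vs st rule: height_matching.induct)
  case (2 h v vs st)
  let ?d = "h (v # vs) - h vs"
  let ?st = "replicate (h vs - h (v # vs)) v @ drop ?d st"
  have sorted: "\<forall>q\<in>set (take ?d st). \<forall>q'\<in>set (drop ?d st). pos q' \<le> pos q"
    using "2.prems"(2) by (metis append_take_drop_id sorted_wrt_append)
  have "sorted_wrt (\<lambda>x y. pos y \<le> pos x) (replicate n v)" for n
    by (induction n) auto
  then have "noncrossing_arcs pos (height_matching h vs ?st)"
    using "2.prems" by (intro "2.IH")
      (auto simp: sorted_wrt_append sorted_wrt_drop dest: in_set_dropD intro: less_imp_le)
  moreover have "(pos v \<le> pos a \<or> (\<forall>q\<in>set (take ?d st). pos a \<le> pos q)) \<and> pos v < pos b"
    if "(a, b) \<in> set (height_matching h vs ?st)" for a b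
    using subsetD[OF height_matching_ends that] "2.prems"(1) sorted
    by (auto intro: less_imp_le)
  moreover have "\<forall>q\<in>set (take ?d st). pos q < pos v"
    using "2.prems"(3) by (auto dest: in_set_takeD)
  ultimately show ?case
    unfolding noncrossing_arcs_def height_matching.simps set_append ball_Un
    by auto fastforce+
qed (simp add: noncrossing_arcs_def)

section \<open>Cuts of demand multisets\<close>

lemma cut_size_empty_mset [simp]: "cut_size {#} X = 0"
  by (simp add: cut_size_def)

lemma cut_size_add_mset [simp]:
  "cut_size (add_mset e H) X = of_bool (card (e \<inter> X) = 1) + cut_size H X"
  by (simp add: cut_size_def)

lemma cut_size_plus: "cut_size (H + H') X = cut_size H X + cut_size H' X"
  by (simp add: cut_size_def)

lemma cut_size_le_size: "cut_size H X \<le> size H"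
  unfolding cut_size_def by (rule size_filter_mset_lesseq)

lemma cut_size_empty [simp]: "cut_size H {} = 0"
  by (induction H) auto

lemma card_doubleton_Int:
  "a \<noteq> b \<Longrightarrow> card ({a, b} \<inter> X) = Suc 0 \<longleftrightarrow> (a \<in> X) \<noteq> (b \<in> X)"
  by (cases "a \<in> X"; cases "b \<in> X") (auto simp: Int_insert_left)

lemma cut_size_sym_diff_le:
  assumes "\<forall>e\<in>#H. card e = 2"
  shows "cut_size H (sym_diff X Y) \<le> cut_size H X + cut_size H Y"
  using assms
proof (induction H)
  case (add e H)
  then obtain a b where "e = {a, b}" "a \<noteq> b" by (auto simp: card_2_iff)
  with add show ?case by (auto simp: card_doubleton_Int)
qed simp

lemma repeat_mset_2: "repeat_mset 2 H = H + H"
  by (simp add: multiset_eq_iff)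

lemma demands_on_add_mset [simp]:
  "demands_on F (add_mset e H) \<longleftrightarrow> e \<subseteq> set F \<and> card e = 2 \<and> demands_on F H"
  by (auto simp: demands_on_def)

lemma demands_on_plus [simp]: "demands_on F (H + H') \<longleftrightarrow> demands_on F H \<and> demands_on F H'"
  by (auto simp: demands_on_def)

definition demands :: "('v \<times> 'v) list \<Rightarrow> 'v set multiset" where
  "demands es = mset (map (\<lambda>(a, b). {a, b}) es)"

lemma demands_simps [simp]:
  "demands [] = {#}"
  "demands ((a, b) # es) = add_mset {a, b} (demands es)"
  "demands (es @ es') = demands es + demands es'"
  by (simp_all add: demands_def)

lemma size_demands [simp]: "size (demands es) = length es"
  by (simp add: demands_def)

lemma cut_size_demands:
  "\<forall>(a, b)\<in>set es. a \<noteq> b \<Longrightarrow> cut_size (demands es) X = cut_count es X X"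
  by (induction es) (auto simp: card_doubleton_Int)

section \<open>Laminar covers on a line\<close>

lemma ex_strict_position:
  assumes "distinct F"
  shows "\<exists>pos :: 'v \<Rightarrow> nat. sorted_wrt (\<lambda>x y. pos x < pos y) F"
proof -
  have "inj_on ((!) F) {..<length F}"
    using assms by (simp add: inj_on_nth)
  then have "the_inv_into {..<length F} ((!) F) (F ! i) = i" if "i < length F" for i
    using that by (simp add: the_inv_into_f_f)
  then show ?thesis
    by (intro exI[of _ "the_inv_into {..<length F} ((!) F)"]) (simp add: sorted_wrt_iff_nth_less)
qed

lemma rotate_via_rotate: "\<exists>k. rotate l xs = rotate k (rotate m xs)"
proof (cases "xs = []")
  case False
  then have "l + (length xs - 1) * m + m = l + length xs * m"
    by (cases xs) auto
  then have "rotate (l + (length xs - 1) * m) (rotate m xs) = rotate (l + length xs * m) xs"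
    by (simp only: rotate_rotate)
  also have "\<dots> = rotate l xs"
    by (metis mod_mult_self2 rotate_conv_mod)
  finally show ?thesis by metis
qed simp

lemma rotate_appendE:
  obtains us vs where "xs = us @ vs" "rotate m xs = vs @ us"
  by (metis append_take_drop_id rotate_drop_take)

lemma set_take_rotate:
  "\<exists>u v w. xs = u @ v @ w \<and>
    (set (take k (rotate m xs)) = set v \<or> set (take k (rotate m xs)) = set u \<union> set w)"
proof -
  obtain a b where xs: "xs = a @ b" and rot: "rotate m xs = b @ a"
    by (rule rotate_appendE)
  show ?thesis
  proof (cases "k \<le> length b")
    case True
    then have "xs = a @ take k b @ drop k b \<and> set (take k (rotate m xs)) = set (take k b)"
      using xs rot by simp
    then show ?thesis by blast
  next
    case False
    let ?k = "k - length b"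
    have "xs = take ?k a @ drop ?k a @ b \<and>
        set (take k (rotate m xs)) = set (take ?k a) \<union> set b"
      using xs rot False by auto
    then show ?thesis by blast
  qed
qed

lemma cut_size_complement:
  assumes "demands_on F H" "X \<union> Y = set F" "X \<inter> Y = {}"
  shows "cut_size H X = cut_size H Y"
  using assms(1)
proof (induction H)
  case (add e H)
  then obtain a b where e: "e = {a, b}" "a \<noteq> b" "{a, b} \<subseteq> X \<union> Y"
    using assms(2) by (auto simp: demands_on_def card_2_iff)
  then have "(a \<in> X) = (a \<notin> Y)" "(b \<in> X) = (b \<notin> Y)"
    using assms(3) by auto
  with add e show ?case by (simp add: card_doubleton_Int demands_on_def)
qed simp

lemma dominated_byI:
  assumes "distinct F" "demands_on F H" "demands_on F H'"
    and "\<And>us vs ws. F = us @ vs @ ws \<Longrightarrow> cut_size H' (set vs) \<le> cut_size H (set vs)"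
  shows "dominated_by F H' H"
  unfolding dominated_by_def
proof (intro allI impI)
  fix S assume "contiguous_segment F S"
  then obtain us vs ws where F: "F = us @ vs @ ws" and S: "S = set vs \<or> S = set us \<union> set ws"
    using set_take_rotate by (metis contiguous_segment_def)
  have "cut_size K S = cut_size K (set vs)" if "demands_on F K" for K
    using S cut_size_complement[OF that, of "set us \<union> set ws" "set vs"] assms(1) F by auto
  then show "cut_size H' S \<le> cut_size H S"
    using assms(2-4) F by simp
qed

lemma subseq_rotateE:
  assumes "subseq ys (rotate m xs)"
  obtains ys1 ys2 where "ys = ys1 @ ys2" "subseq (ys2 @ ys1) xs"
proof -
  obtain a b where xs: "xs = a @ b" and rot: "rotate m xs = b @ a"
    by (rule rotate_appendE)
  from assms obtain ys1 ys2 where "ys = ys1 @ ys2" "subseq ys1 b" "subseq ys2 a"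
    unfolding rot by (auto simp: subseq_append_iff)
  then show ?thesis using that xs by (metis list_emb_append_mono)
qed

lemma crossingE:
  assumes "crossing F e f"
  obtains a b c d where "subseq [a, b, c, d] F"
    "e = {a, c} \<and> f = {b, d} \<or> f = {a, c} \<and> e = {b, d}"
proof -
  obtain u v x y m where ef: "e = {u, v}" "f = {x, y}" and "subseq [u, x, v, y] (rotate m F)"
    using assms by (auto simp: crossing_def)
  then obtain ys1 ys2 where ys: "[u, x, v, y] = ys1 @ ys2" and sub: "subseq (ys2 @ ys1) F"
    by (metis subseq_rotateE)
  have "ys2 @ ys1 \<in> {[u, x, v, y], [x, v, y, u], [v, y, u, x], [y, u, x, v]}"
    using ys by (auto simp: Cons_eq_append_conv)
  then show ?thesis using sub that ef by (elim insertE emptyE; simp) (metis insert_commute)+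
qed

lemma sorted_wrt_subseq: "subseq xs ys \<Longrightarrow> sorted_wrt R ys \<Longrightarrow> sorted_wrt R xs"
proof (induction rule: list_emb.induct)
  case (list_emb_Cons2 x y xs ys)
  then show ?case using list_emb_set[of "(=)" xs ys] by fastforce
qed auto

lemma laminar_demands_noncrossing:
  assumes F: "sorted_wrt (\<lambda>x y. pos x < pos y) F"
    and es: "noncrossing_arcs pos es" "set es \<subseteq> set F \<times> set F"
  shows "laminar_demands F (demands es)"
  unfolding laminar_demands_def
proof (intro conjI ballI notI)
  show "demands_on F (demands es)"
    using es by (fastforce simp: demands_on_def demands_def noncrossing_arcs_def card_insert_if)
next
  fix e f assume "e \<in># demands es" "f \<in># demands es" and "crossing F e f"
  then obtain q v q' v' where qv: "(q, v) \<in> set es" "e = {q, v}"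
    and q'v': "(q', v') \<in> set es" "f = {q', v'}"
    by (auto simp: demands_def)
  obtain a b c d where "subseq [a, b, c, d] F"
    and abcd: "{q, v} = {a, c} \<and> {q', v'} = {b, d} \<or> {q', v'} = {a, c} \<and> {q, v} = {b, d}"
    using crossingE[OF \<open>crossing F e f\<close>] qv(2) q'v'(2) by metis
  then have "pos a < pos b" "pos b < pos c" "pos c < pos d"
    using sorted_wrt_subseq[OF _ F] by fastforce+
  moreover have "pos q < pos v" "pos q' < pos v'"
    using es(1) qv(1) q'v'(1) by (auto simp: noncrossing_arcs_def)
  ultimately have "(a, c) \<in> set es \<and> (b, d) \<in> set es"
    using abcd qv(1) q'v'(1) by (auto simp: doubleton_eq_iff)
  then show False
    using es(1) \<open>pos a < pos b\<close> \<open>pos b < pos c\<close> \<open>pos c < pos d\<close>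
    unfolding noncrossing_arcs_def by blast
qed

lemma laminar_height_matching:
  assumes "distinct F" "subseq vs F"
  shows "laminar_demands F (demands (height_matching h vs []))"
proof -
  obtain pos :: "'a \<Rightarrow> nat" where pos: "sorted_wrt (\<lambda>x y. pos x < pos y) F"
    using ex_strict_position[OF assms(1)] by blast
  have "noncrossing_arcs pos (height_matching h vs [])"
    by (rule noncrossing_height_matching) (use sorted_wrt_subseq[OF assms(2) pos] in auto)
  moreover have "set vs \<subseteq> set F"
    using list_emb_set[OF assms(2)] by blast
  then have "set (height_matching h vs []) \<subseteq> set F \<times> set F"
    using height_matching_ends[of h vs "[]"] by auto
  ultimately show ?thesis
    by (rule laminar_demands_noncrossing[OF pos])
qed

lemma cut_size_height_matching:
  assumes "distinct vs"
  shows "cut_size (demands (height_matching h vs [])) X = cut_count (height_matching h vs []) X X"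
proof (rule cut_size_demands)
  have "demands_on vs (demands (height_matching h vs []))"
    using laminar_height_matching[OF assms] by (simp add: laminar_demands_def)
  then show "\<forall>(a, b)\<in>set (height_matching h vs []). a \<noteq> b"
    by (fastforce simp: demands_on_def demands_def)
qed

section \<open>Demands between the two sides of a line\<close>

definition min_cut :: "'v set multiset \<Rightarrow> 'v set \<Rightarrow> 'v list \<Rightarrow> nat" where
  "min_cut D X ys = (MIN qs\<in>set (prefixes ys). cut_size D (X \<union> set qs))"

lemma min_cut_le: "prefix qs ys \<Longrightarrow> min_cut D X ys \<le> cut_size D (X \<union> set qs)"
  unfolding min_cut_def by (intro Min_le) auto

lemma min_cut_attained:
  obtains qs where "prefix qs ys" "min_cut D X ys = cut_size D (X \<union> set qs)"
proof -
  have "min_cut D X ys \<in> (\<lambda>qs. cut_size D (X \<union> set qs)) ` set (prefixes ys)"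
    unfolding min_cut_def by (intro Min_in) auto
  then show ?thesis using that by auto
qed

lemma min_cut_Nil [simp]: "min_cut D X [] = cut_size D X"
  by (simp add: min_cut_def)

lemma min_cut_Cons:
  "min_cut D X (y # ys) = min (cut_size D X) (min_cut D (insert y X) ys)"
  by (simp add: min_cut_def image_image)

lemma min_cut_empty [simp]: "min_cut D {} ys = 0"
  using min_cut_le[of "[]" ys D "{}"] by simp

lemma min_cut_le_size: "min_cut D X ys \<le> size D"
  using min_cut_le[of "[]" ys D X] cut_size_le_size[of D X] by simp

lemma min_cut_sym_diff_le:
  assumes "\<forall>e\<in>#H. card e = 2" "Y \<inter> set ys = {}"
  shows "min_cut H (sym_diff X Y) ys \<le> min_cut H X ys + cut_size H Y"
proof -
  obtain qs where qs: "prefix qs ys" "min_cut H X ys = cut_size H (X \<union> set qs)"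
    by (rule min_cut_attained)
  have "Y \<inter> set qs = {}" using assms(2) set_mono_prefix[OF qs(1)] by blast
  then have "sym_diff X Y \<union> set qs = sym_diff (X \<union> set qs) Y" by blast
  then show ?thesis
    using min_cut_le[OF qs(1), of H "sym_diff X Y"] cut_size_sym_diff_le[OF assms(1)] qs(2)
    by (metis le_trans)
qed

definition cut_matching :: "'v set multiset \<Rightarrow> 'v list \<Rightarrow> 'v list \<Rightarrow> ('v \<times> 'v) list" where
  "cut_matching D vs ys = height_matching (\<lambda>xs. min_cut D (set xs) ys) vs []"

lemma length_cut_matching: "length (cut_matching D vs ys) \<le> length vs * size D"
  unfolding cut_matching_def by (intro length_height_matching min_cut_le_size)

lemma cut_size_cut_matching:
  assumes "distinct (us @ vs @ ws)" "min_cut D (set (us @ vs @ ws)) ys = 0"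
  obtains xs where "suffix xs vs" "min_cut D (set (xs @ ws)) ys \<le> min_cut D (set (vs @ ws)) ys"
    "min_cut D (set (xs @ ws)) ys \<le> min_cut D (set ws) ys"
    "cut_size (demands (cut_matching D (us @ vs @ ws) ys)) (set vs) +
       2 * min_cut D (set (xs @ ws)) ys = min_cut D (set (vs @ ws)) ys + min_cut D (set ws) ys"
proof -
  have "min_cut D (set []) ys = 0" by simp
  from this assms(2,1) show ?thesis
    using that unfolding cut_matching_def cut_size_height_matching[OF assms(1)]
    by (rule cut_count_height_matching_interval)
qed

lemma cut_matching_subset:
  assumes "set vs \<subseteq> A"
  shows "set (cut_matching D vs ys) \<subseteq> A \<times> A"
  unfolding cut_matching_def using height_matching_ends[of _ vs "[]"] assms by fastforce

lemma laminar_cut_matching: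
  "distinct F \<Longrightarrow> subseq vs F \<Longrightarrow> laminar_demands F (demands (cut_matching D vs ys))"
  unfolding cut_matching_def by (rule laminar_height_matching)

lemma cut_size_cut_matching_Int:
  assumes "distinct vs"
  shows "cut_size (demands (cut_matching D vs ys)) X =
    cut_size (demands (cut_matching D vs ys)) (X \<inter> set vs)"
proof -
  let ?M = "cut_matching D vs ys"
  have "cut_count ?M X X = cut_count ?M (X \<inter> set vs) (X \<inter> set vs)"
    using cut_matching_subset[of vs "set vs" D ys] by (intro cut_count_cong) auto
  then show ?thesis
    unfolding cut_matching_def by (simp add: cut_size_height_matching[OF assms])
qed

definition straight_matching :: "'v set multiset \<Rightarrow> 'v list \<Rightarrow> 'v list \<Rightarrow> ('v \<times> 'v) list" where
  "straight_matching D ss ts = cut_matching D (ss @ ts) []"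

definition doubled_matching :: "'v set multiset \<Rightarrow> 'v list \<Rightarrow> 'v list \<Rightarrow> ('v \<times> 'v) list" where
  "doubled_matching D ss ts = cut_matching D ss ts @ cut_matching D ss ts"

locale bipartite_demands =
  fixes es :: "('v \<times> 'v) list" and S T :: "'v set"
  assumes disjoint: "S \<inter> T = {}" and edges: "set es \<subseteq> S \<times> T"
begin

abbreviation \<delta> :: "'v set \<Rightarrow> nat" where
  "\<delta> \<equiv> cut_size (demands es)"

lemma cut_size_conv_cut_count: "\<delta> X = cut_count es X X"
  by (rule cut_size_demands) (use edges disjoint in fastforce)

lemma cut_size_Un_sides:
  assumes "P \<subseteq> S" "Q \<subseteq> T"
  shows "\<delta> (P \<union> Q) = cut_count es P Q"
  unfolding cut_size_conv_cut_count
  by (rule cut_count_cong) (use assms edges disjoint in blast)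

lemma cut_size_left: "P \<subseteq> S \<Longrightarrow> \<delta> P = cut_count es P {}"
  using cut_size_Un_sides[of P "{}"] by simp

lemma cut_size_right: "Q \<subseteq> T \<Longrightarrow> \<delta> Q = cut_count es {} Q"
  using cut_size_Un_sides[of "{}" Q] by simp

lemma cut_size_Un_same_side:
  assumes "X \<union> Y \<subseteq> S \<or> X \<union> Y \<subseteq> T" "X \<inter> Y = {}"
  shows "\<delta> (X \<union> Y) = \<delta> X + \<delta> Y"
proof -
  have "\<forall>(a, b)\<in>set es. a \<notin> X \<union> Y \<or> b \<notin> X \<union> Y"
    using assms(1) edges disjoint by fast
  then have "cut_count es (X \<union> Y) (X \<union> Y) = cut_count es X X + cut_count es Y Y"
    using assms(2) by (induction es) auto
  then show ?thesis by (simp add: cut_size_conv_cut_count)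
qed

lemma cut_size_Un_right_side:
  assumes "P \<subseteq> S"
  shows "\<delta> (P \<union> T) = \<delta> (S - P)"
proof -
  have "cut_count es P T = cut_count es (S - P) {}"
    using edges by (induction es) auto
  with assms show ?thesis by (simp add: cut_size_Un_sides cut_size_left)
qed

lemma cut_size_uncross_superset:
  assumes "P \<subseteq> S" "Q \<subseteq> Q'" "Q' \<subseteq> T"
  shows "\<delta> (P \<union> Q) + \<delta> (P \<union> T) \<le> \<delta> (T - Q) + 2 * \<delta> (P \<union> Q')"
proof -
  have "cut_count es P Q + cut_count es P T \<le> cut_count es {} (T - Q) + 2 * cut_count es P Q'"
    using edges assms(2) by (induction es) (auto simp: of_bool_def)
  with assms show ?thesis by (simp add: cut_size_Un_sides cut_size_right)
qed

lemma cut_size_uncross_subset: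
  assumes "P \<subseteq> S" "Q' \<subseteq> Q" "Q \<subseteq> T"
  shows "\<delta> (P \<union> Q) + \<delta> (T - Q) \<le> \<delta> (P \<union> T) + 2 * \<delta> (P \<union> Q')"
proof -
  have "cut_count es P Q + cut_count es {} (T - Q) \<le> cut_count es P T + 2 * cut_count es P Q'"
    using edges assms(2) by (induction es) (auto simp: of_bool_def)
  with assms show ?thesis by (simp add: cut_size_Un_sides cut_size_right)
qed

lemma cut_size_left_mono: "P \<subseteq> P' \<Longrightarrow> P' \<subseteq> S \<Longrightarrow> \<delta> P \<le> \<delta> P'"
  using cut_size_Un_same_side[of P "P' - P"] by (simp add: Un_absorb1)

end

locale bipartite_line =
  fixes es :: "('v \<times> 'v) list" and ss ts :: "'v list"
  assumes distinct: "distinct (ss @ ts)" and edges: "set es \<subseteq> set ss \<times> set ts"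
begin

sublocale bipartite_demands es "set ss" "set ts"
  by unfold_locales (use distinct edges in auto)

lemma card_demands: "\<forall>e\<in>#demands es. card e = 2"
  using edges disjoint by (fastforce simp: demands_def card_2_iff)

lemma interval_cases:
  assumes "ss @ ts = us @ vs @ ws"
  obtains (left) xs where "ss = us @ vs @ xs" "ws = xs @ ts"
    | (right) xs where "us = ss @ xs" "ts = xs @ vs @ ws"
    | (middle) ps qs where "vs = ps @ qs" "ss = us @ ps" "ts = qs @ ws"
  using assms by (fastforce simp: append_eq_append_conv2)

abbreviation straight :: "('v \<times> 'v) list" where
  "straight \<equiv> straight_matching (demands es) ss ts"

abbreviation lefts :: "('v \<times> 'v) list" where
  "lefts \<equiv> cut_matching (demands es) ss ts"

lemma cut_size_suffix_quasiconcave: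
  assumes "suffix (vs @ ws) (ss @ ts)" "suffix xs vs"
  shows "min (\<delta> (set (vs @ ws))) (\<delta> (set ws)) \<le> \<delta> (set (xs @ ws))"
proof -
  obtain ys where vs: "vs = ys @ xs" using assms(2) by (auto elim: suffixE)
  have "suffix (xs @ ws) ts \<or> suffix ts (xs @ ws)"
    using assms(1) vs by (metis suffix_same_cases suffix_appendD suffixI append.assoc)
  then show ?thesis
  proof
    assume "suffix (xs @ ws) ts"
    then have "set (xs @ ws) \<subseteq> set ts" "set xs \<inter> set ws = {}"
      using set_mono_suffix distinct by (auto elim!: suffixE)
    then show ?thesis using cut_size_Un_same_side[of "set xs" "set ws"] by simp
  next
    assume "suffix ts (xs @ ws)"
    then obtain zs where zs: "xs @ ws = zs @ ts" by (auto elim: suffixE)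
    then have "suffix (ys @ zs) ss" using assms(1) vs by (auto simp: suffix_def)
    then have "set (ys @ zs) \<subseteq> set ss" by (rule set_mono_suffix)
    then have "\<delta> (set (ys @ zs @ ts)) \<le> \<delta> (set (zs @ ts))"
      using cut_size_Un_right_side[of "set (ys @ zs)"] cut_size_Un_right_side[of "set zs"]
        cut_size_left_mono[of "set ss - set (ys @ zs)" "set ss - set zs"]
      by (auto simp: Un_assoc)
    then show ?thesis using vs zs by (simp add: min.coboundedI1 flip: set_append)
  qed
qed

lemma cut_size_both_sides: "\<delta> (set ss \<union> set ts) = 0"
  using cut_size_Un_right_side[of "set ss"] by simp

lemma cut_size_straight:
  assumes "ss @ ts = us @ vs @ ws"
  shows "int (cut_size (demands straight) (set vs)) =
    \<bar>int (\<delta> (set vs \<union> set ws)) - int (\<delta> (set ws))\<bar>"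
proof -
  have "distinct (us @ vs @ ws)" "\<delta> (set (us @ vs @ ws)) = 0"
    using distinct cut_size_both_sides by (simp_all flip: assms)
  then obtain xs where xs: "suffix xs vs" "\<delta> (set (xs @ ws)) \<le> \<delta> (set (vs @ ws))"
    "\<delta> (set (xs @ ws)) \<le> \<delta> (set ws)"
    "cut_size (demands straight) (set vs) + 2 * \<delta> (set (xs @ ws)) = \<delta> (set (vs @ ws)) + \<delta> (set ws)"
    using cut_size_cut_matching[of us vs ws "demands es" "[]"]
    unfolding straight_matching_def assms min_cut_Nil by metis
  have "suffix (vs @ ws) (ss @ ts)" using assms by (simp add: suffix_def)
  then have "min (\<delta> (set (vs @ ws))) (\<delta> (set ws)) \<le> \<delta> (set (xs @ ws))"
    using xs(1) by (rule cut_size_suffix_quasiconcave)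
  with xs(2-4) show ?thesis by (simp add: min_def split: if_splits)
qed

lemma cut_size_lefts:
  assumes "ss = us @ vs @ ws"
  obtains xs where "suffix xs vs"
    "min_cut (demands es) (set (xs @ ws)) ts \<le> min_cut (demands es) (set ws) ts"
    "cut_size (demands lefts) (set vs) + 2 * min_cut (demands es) (set (xs @ ws)) ts =
      min_cut (demands es) (set (vs @ ws)) ts + min_cut (demands es) (set ws) ts"
proof -
  have "distinct (us @ vs @ ws)" "min_cut (demands es) (set (us @ vs @ ws)) ts = 0"
    using distinct cut_size_both_sides min_cut_le[of ts ts "demands es" "set ss"]
    by (simp_all flip: assms)
  then show ?thesis
    using cut_size_cut_matching[of us vs ws "demands es" ts] that unfolding assms by metis
qed

lemma cut_size_lefts_straddling:
  assumes "ss = us @ ps" "ts = qs @ ws"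
  shows "cut_size (demands lefts) (set (ps @ qs)) = min_cut (demands es) (set ps) ts"
proof -
  have "set (ps @ qs) \<inter> set ss = set ps" using assms distinct by auto
  then have "cut_size (demands lefts) (set (ps @ qs)) = cut_size (demands lefts) (set ps)"
    using cut_size_cut_matching_Int[of ss _ _ "set (ps @ qs)"] distinct by simp
  also have "\<dots> = min_cut (demands es) (set ps) ts"
    using cut_size_lefts[of us ps "[]"] assms(1) by auto
  finally show ?thesis .
qed

lemma cut_size_straight_le:
  assumes "ss @ ts = us @ vs @ ws"
  shows "cut_size (demands straight) (set vs) \<le> \<delta> (set vs)"
proof -
  have "set vs \<inter> set ws = {}" using distinct unfolding assms by auto
  then have "sym_diff (set vs) (set ws) = set vs \<union> set ws"
    "sym_diff (set vs \<union> set ws) (set vs) = set ws" by blast+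
  then have "\<delta> (set vs \<union> set ws) \<le> \<delta> (set vs) + \<delta> (set ws)"
    "\<delta> (set ws) \<le> \<delta> (set vs \<union> set ws) + \<delta> (set vs)"
    using cut_size_sym_diff_le[OF card_demands] by metis+
  then show ?thesis using cut_size_straight[OF assms] by linarith
qed

lemma cut_size_lefts_le_inside:
  assumes "ss = us @ vs @ ws"
  shows "cut_size (demands lefts) (set vs) \<le> \<delta> (set vs)"
proof -
  let ?h = "\<lambda>xs. min_cut (demands es) (set xs) ts"
  obtain xs where "suffix xs vs" and cut:
    "cut_size (demands lefts) (set vs) + 2 * ?h (xs @ ws) = ?h (vs @ ws) + ?h ws"
    using cut_size_lefts[OF assms] by blast
  then obtain ys where vs: "vs = ys @ xs" by (auto elim: suffixE)
  have parts: "set ys \<inter> set (xs @ ws) = {}" "set xs \<inter> set ws = {}"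
    "set ys \<inter> set ts = {}" "set xs \<inter> set ts = {}" "set ys \<union> set xs \<subseteq> set ss"
    using distinct unfolding assms vs by auto
  have "sym_diff (set (xs @ ws)) (set ys) = set (vs @ ws)"
    "sym_diff (set (xs @ ws)) (set xs) = set ws"
    using parts(1,2) vs by auto
  then have "?h (vs @ ws) \<le> ?h (xs @ ws) + \<delta> (set ys)" "?h ws \<le> ?h (xs @ ws) + \<delta> (set xs)"
    using min_cut_sym_diff_le[OF card_demands] parts(3,4) by metis+
  moreover have "\<delta> (set vs) = \<delta> (set ys) + \<delta> (set xs)"
    unfolding vs set_append by (rule cut_size_Un_same_side) (use parts in auto)
  ultimately show ?thesis using cut by linarith
qed

lemma cut_size_lefts_le:
  assumes "ss @ ts = us @ vs @ ws"
  shows "cut_size (demands lefts) (set vs) \<le> \<delta> (set vs)"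
  using assms
proof (cases rule: interval_cases)
  case left
  show ?thesis by (rule cut_size_lefts_le_inside[OF left(1)])
next
  case right
  then have "set vs \<inter> set ss = {}" using distinct by auto
  then show ?thesis
    using cut_size_cut_matching_Int[of ss _ _ "set vs"] distinct by simp
next
  case (middle ps qs)
  then show ?thesis
    using cut_size_lefts_straddling[OF middle(2,3)] min_cut_le[of qs ts] by simp
qed

lemma cut_size_le_straight_lefts_straddling:
  assumes "ss = us @ ps" "ts = qs @ ws"
  shows "\<delta> (set (ps @ qs)) \<le>
    cut_size (demands straight) (set (ps @ qs)) + 2 * cut_size (demands lefts) (set (ps @ qs))"
proof -
  obtain qs' where qs': "prefix qs' ts" "min_cut (demands es) (set ps) ts = \<delta> (set ps \<union> set qs')"
    by (rule min_cut_attained)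
  have sets: "set ps \<subseteq> set ss" "set qs \<subseteq> set ts" "set qs' \<subseteq> set ts" "set ts - set qs = set ws"
    using assms distinct set_mono_prefix[OF qs'(1)] by auto
  have "set qs \<subseteq> set qs' \<or> set qs' \<subseteq> set qs"
    using prefix_same_cases[OF qs'(1)] assms(2) set_mono_prefix by (metis prefixI)
  then have "int (\<delta> (set ps \<union> set qs)) \<le>
      \<bar>int (\<delta> (set ps \<union> set ts)) - int (\<delta> (set ws))\<bar> + 2 * int (\<delta> (set ps \<union> set qs'))"
    using cut_size_uncross_superset[of "set ps" "set qs" "set qs'"]
      cut_size_uncross_subset[of "set ps" "set qs'" "set qs"] sets by auto
  moreover have "set (ps @ qs) \<union> set ws = set ps \<union> set ts" using assms by auto
  ultimately show ?thesis
    using cut_size_straight[of us "ps @ qs" ws] cut_size_lefts_straddling[OF assms] assms qs'(2)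
    by simp
qed

lemma cut_size_le_straight_lefts:
  assumes "ss @ ts = us @ vs @ ws"
  shows "\<delta> (set vs) \<le> cut_size (demands straight) (set vs) + 2 * cut_size (demands lefts) (set vs)"
  using assms
proof (cases rule: interval_cases)
  case (left xs)
  then have "set ss - (set vs \<union> set xs) = set us" "set ss - set xs = set us \<union> set vs"
    using distinct by auto
  then have "\<delta> (set vs \<union> set ws) = \<delta> (set us)" "\<delta> (set ws) = \<delta> (set us \<union> set vs)"
    using cut_size_Un_right_side[of "set vs \<union> set xs"] cut_size_Un_right_side[of "set xs"] left
    by (auto simp: Un_assoc)
  moreover have "\<delta> (set us \<union> set vs) = \<delta> (set us) + \<delta> (set vs)"
    by (rule cut_size_Un_same_side) (use left distinct in auto)
  ultimately show ?thesis using cut_size_straight[OF assms] by linarith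
next
  case (right xs)
  have "\<delta> (set vs \<union> set ws) = \<delta> (set vs) + \<delta> (set ws)"
    by (rule cut_size_Un_same_side) (use right distinct in auto)
  then show ?thesis using cut_size_straight[OF assms] by linarith
next
  case (middle ps qs)
  show ?thesis
    unfolding middle(1) by (rule cut_size_le_straight_lefts_straddling[OF middle(2,3)])
qed

lemma laminar_cover_line:
  "laminar_cover (ss @ ts) (demands es) (demands straight)
    (demands (doubled_matching (demands es) ss ts))"
proof -
  have straight: "laminar_demands (ss @ ts) (demands straight)"
    and lefts: "laminar_demands (ss @ ts) (demands lefts)"
    using distinct
    by (simp_all add: straight_matching_def laminar_cut_matching subseq_rev_drop_many
        del: subseq_append)
  have on: "demands_on (ss @ ts) (demands straight)" "demands_on (ss @ ts) (demands lefts)"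
    using straight lefts by (simp_all add: laminar_demands_def)
  have es: "demands_on (ss @ ts) (demands es)"
    using edges card_demands by (fastforce simp: demands_on_def demands_def)
  have doubled: "demands (doubled_matching (demands es) ss ts) = demands lefts + demands lefts"
    by (simp add: doubled_matching_def)
  note dominated = dominated_byI[OF distinct]
  have "dominated_by (ss @ ts) (demands straight) (demands es)"
    by (rule dominated[OF es on(1) cut_size_straight_le])
  moreover have
    "dominated_by (ss @ ts) (demands lefts + demands lefts) (repeat_mset 2 (demands es))"
    by (rule dominated)
      (use cut_size_lefts_le es on in \<open>simp_all add: repeat_mset_2 cut_size_plus add_mono\<close>)
  moreover have
    "dominated_by (ss @ ts) (demands es) (demands straight + (demands lefts + demands lefts))"
    by (rule dominated)
      (use cut_size_le_straight_lefts es on in \<open>simp_all add: cut_size_plus mult_2\<close>)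
  ultimately show ?thesis
    using straight lefts by (auto simp: laminar_cover_def laminar_demands_def doubled)
qed

end

section \<open>Demands on a cycle\<close>

lemma contiguous_segment_rotate [simp]:
  "contiguous_segment (rotate m F) S \<longleftrightarrow> contiguous_segment F S"
  unfolding contiguous_segment_def by (metis rotate_rotate rotate_via_rotate)

lemma crossing_rotate [simp]: "crossing (rotate m F) e f \<longleftrightarrow> crossing F e f"
  unfolding crossing_def by (metis rotate_rotate rotate_via_rotate)

lemma laminar_cover_rotate [simp]:
  "laminar_cover (rotate m F) D L1 L2 \<longleftrightarrow> laminar_cover F D L1 L2"
  by (simp add: laminar_cover_def laminar_demands_def dominated_by_def demands_on_def)

lemma subseq_mapE:
  assumes "subseq xs (map f ys)"
  obtains zs where "xs = map f zs" "subseq zs ys"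
  using assms by (auto simp: subseq_conv_nths nths_map)

lemma card_image_Int_image:
  assumes "inj_on f A" "X \<subseteq> A" "Y \<subseteq> A"
  shows "card (f ` X \<inter> f ` Y) = card (X \<inter> Y)"
proof -
  have "f ` X \<inter> f ` Y = f ` (X \<inter> Y)"
    using assms by (simp add: inj_on_image_Int)
  moreover have "inj_on f (X \<inter> Y)"
    using assms(1,2) by (auto intro: inj_on_subset)
  ultimately show ?thesis by (simp add: card_image)
qed

context
  fixes f :: "'a \<Rightarrow> 'b" and F :: "'a list"
  assumes inj: "inj_on f (set F)"
begin

lemma crossing_map:
  assumes "crossing (map f F) (f ` e) (f ` g)" "e \<subseteq> set F" "g \<subseteq> set F"
  shows "crossing F e g"
proof -
  obtain u v x y m where eg: "f ` e = {u, v}" "f ` g = {x, y}"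
    and "subseq [u, x, v, y] (map f (rotate m F))"
    using assms(1) by (auto simp: crossing_def rotate_map)
  then obtain a b c d
    where abcd: "[u, x, v, y] = map f [a, b, c, d]" "subseq [a, b, c, d] (rotate m F)"
    by (elim subseq_mapE) (auto simp: Cons_eq_map_conv)
  have "set [a, b, c, d] \<subseteq> set F"
    using list_emb_set[OF abcd(2)] by auto
  then have "e = {a, c}" "g = {b, d}"
    using eg abcd(1) assms(2,3) inj_on_image_eq_iff[OF inj, of e "{a, c}"]
      inj_on_image_eq_iff[OF inj, of g "{b, d}"] by auto
  then show ?thesis using abcd(2) unfolding crossing_def by blast
qed

lemma demands_on_map:
  assumes "\<forall>e\<in>#H. e \<subseteq> set F"
  shows "demands_on (map f F) (image_mset ((`) f) H) \<longleftrightarrow> demands_on F H"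
proof -
  have "card (f ` e) = card e" if "e \<in># H" for e
    using assms that inj by (intro card_image) (auto intro: inj_on_subset)
  with assms show ?thesis by (auto simp: demands_on_def)
qed

lemma cut_size_image:
  assumes "demands_on F H" "X \<subseteq> set F"
  shows "cut_size (image_mset ((`) f) H) (f ` X) = cut_size H X"
  using assms(1)
proof (induction H)
  case (add e H)
  then show ?case using card_image_Int_image[OF inj _ assms(2), of e] by (simp add: demands_on_def)
qed simp

lemma dominated_by_map:
  assumes "demands_on F H" "demands_on F H'" "dominated_by F H H'"
  shows "dominated_by (map f F) (image_mset ((`) f) H) (image_mset ((`) f) H')"
  unfolding dominated_by_def
proof (intro allI impI)
  fix S assume "contiguous_segment (map f F) S"
  then obtain m k where S: "S = f ` set (take k (rotate m F))"
    by (auto simp: contiguous_segment_def rotate_map take_map)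
  have "set (take k (rotate m F)) \<subseteq> set F"
    using set_take_subset by fastforce
  moreover have "contiguous_segment F (set (take k (rotate m F)))"
    unfolding contiguous_segment_def by blast
  ultimately show "cut_size (image_mset ((`) f) H) S \<le> cut_size (image_mset ((`) f) H') S"
    using assms by (simp add: S cut_size_image dominated_by_def)
qed

lemma laminar_demands_map:
  assumes "laminar_demands F L"
  shows "laminar_demands (map f F) (image_mset ((`) f) L)"
  unfolding laminar_demands_def
proof (intro conjI ballI)
  have L: "demands_on F L" "\<forall>e\<in>#L. \<forall>g\<in>#L. \<not> crossing F e g"
    using assms by (simp_all add: laminar_demands_def)
  show "demands_on (map f F) (image_mset ((`) f) L)"
    using L(1) demands_on_map by (simp add: demands_on_def)
  fix e' g' assume "e' \<in># image_mset ((`) f) L" "g' \<in># image_mset ((`) f) L"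
  then obtain e g where "e \<in># L" "g \<in># L" "e' = f ` e" "g' = f ` g" by auto
  then show "\<not> crossing (map f F) e' g'"
    using crossing_map L by (meson demands_on_def)
qed

lemma laminar_cover_map:
  assumes "demands_on F D" "laminar_cover F D L1 L2"
  shows "laminar_cover (map f F) (image_mset ((`) f) D)
    (image_mset ((`) f) L1) (image_mset ((`) f) L2)"
proof -
  have "demands_on F L1" "demands_on F L2"
    using assms(2) by (simp_all add: laminar_cover_def laminar_demands_def)
  with assms show ?thesis
    unfolding laminar_cover_def repeat_mset_2 image_mset_union[symmetric]
    by (simp add: laminar_demands_map dominated_by_map del: image_mset_union)
qed

end

lemma ex_oriented_demands:
  assumes "demands_on F D" "set F = S \<union> T" "S \<inter> T = {}" "\<forall>e\<in>#D. card (e \<inter> S) = 1"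
  shows "\<exists>es. D = demands es \<and> set es \<subseteq> S \<times> T"
  using assms(1,4)
proof (induction D)
  case (add e D)
  then obtain es where es: "D = demands es" "set es \<subseteq> S \<times> T"
    by (auto simp: demands_on_def)
  obtain u v where "e = {u, v}" "u \<noteq> v" "{u, v} \<subseteq> S \<union> T" "(u \<in> S) \<noteq> (v \<in> S)"
    using add.prems assms(2) by (auto simp: card_2_iff card_doubleton_Int)
  then obtain a b where "e = {a, b}" "a \<in> S" "b \<in> T" by blast
  with es have "add_mset e D = demands ((a, b) # es) \<and> set ((a, b) # es) \<subseteq> S \<times> T" by simp
  then show ?case by blast
qed (auto intro: exI[of _ "[]"])

theorem laminar_cover_cycle:
  assumes "distinct F" "demands_on F D" "rotate m F = ss @ ts" "\<forall>e\<in>#D. card (e \<inter> set ss) = 1"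
  shows "laminar_cover F D
    (demands (straight_matching D ss ts)) (demands (doubled_matching D ss ts))"
proof -
  have distinct: "distinct (ss @ ts)" using assms(1) by (simp flip: assms(3))
  have "set F = set ss \<union> set ts" using arg_cong[OF assms(3), of set] by simp
  then obtain es where D: "D = demands es" and "set es \<subseteq> set ss \<times> set ts"
    using ex_oriented_demands[OF assms(2) _ _ assms(4)] distinct by auto
  with distinct interpret bipartite_line es ss ts by unfold_locales
  have "laminar_cover (rotate m F) D (demands straight) (demands (doubled_matching D ss ts))"
    unfolding assms(3) D by (rule laminar_cover_line)
  then show ?thesis by (simp add: D)
qed

section \<open>The program\<close>

text \<open>
  Unary numbers are lists of empty trees, so \<open>Take\<close> also computes minima and \<open>Drop\<close> also computes
  truncated differences. The language has no local definitions; an expression bound by \<open>let\<close> is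
  evaluated at each of its uses.
\<close>

datatype routine =
  Solve | Cover | Match | Min_Cut | Cut | Member | Equal | Push | Pop | Upto | Append | Take | Drop

primrec index :: "routine \<Rightarrow> nat" where
  "index Solve = 0"
| "index Cover = 1"
| "index Match = 2"
| "index Min_Cut = 3"
| "index Cut = 4"
| "index Member = 5"
| "index Equal = 6"
| "index Push = 7"
| "index Pop = 8"
| "index Upto = 9"
| "index Append = 10"
| "index Take = 11"
| "index Drop = 12"

definition call :: "routine \<Rightarrow> expr list \<Rightarrow> expr" where
  "call f es = Call (index f) es"

primrec body :: "routine \<Rightarrow> expr" where
  "body Solve =
     (let n = Left (Arg 0); m = Left (Left (Right (Arg 0))); k = Right (Left (Right (Arg 0)));
          es = Right (Right (Arg 0)); upto = call Upto [Empty, n];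
          cycle = call Append [call Drop [m, upto], call Take [m, upto]]
      in call Cover [es, call Take [k, cycle], call Drop [k, cycle]])"
| "body Cover =
     (let es = Arg 0; ss = Arg 1; ts = Arg 2; lefts = call Match [es, ss, ts, Empty]
      in Pairing
        (call Match [es, call Append [ss, ts], Empty, Empty])
        (call Append [lefts, lefts]))"
| "body Match =
     (let es = Arg 0; v = Left (Arg 1); vs = Right (Arg 1); ys = Arg 2; st = Arg 3;
          height = call Min_Cut [es, Arg 1, ys]; height' = call Min_Cut [es, vs, ys];
          pops = call Drop [height', height]; pushes = call Drop [height, height']
      in Cond (Arg 1)
        (call Pop [pops, v, st,
          call Match [es, vs, ys, call Push [pushes, v, call Drop [pops, st]]]])
        Empty)"
| "body Min_Cut =
     (let es = Arg 0; xs = Arg 1; y = Left (Arg 2); ys = Right (Arg 2); cut = call Cut [es, xs]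
      in Cond (Arg 2) (call Take [cut, call Min_Cut [es, Pairing y xs, ys]]) cut)"
| "body Cut =
     (let a = Left (Left (Arg 0)); b = Right (Left (Arg 0)); xs = Arg 1;
          cut = call Cut [Right (Arg 0), xs]
      in Cond (Arg 0)
        (Cond (call Member [a, xs])
          (Cond (call Member [b, xs]) cut (Pairing Empty cut))
          (Cond (call Member [b, xs]) (Pairing Empty cut) cut))
        Empty)"
| "body Member =
     Cond (Arg 1)
       (Cond (call Equal [Arg 0, Left (Arg 1)])
         (Pairing Empty Empty)
         (call Member [Arg 0, Right (Arg 1)]))
       Empty"
| "body Equal =
     Cond (call Drop [Arg 0, Arg 1])
       Empty
       (Cond (call Drop [Arg 1, Arg 0]) Empty (Pairing Empty Empty))"
| "body Push =
     Cond (Arg 0) (Pairing (Arg 1) (call Push [Right (Arg 0), Arg 1, Arg 2])) (Arg 2)"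
| "body Pop =
     Cond (Arg 0)
       (Cond (Arg 2)
         (Pairing (Pairing (Left (Arg 2)) (Arg 1))
           (call Pop [Right (Arg 0), Arg 1, Right (Arg 2), Arg 3]))
         (Arg 3))
       (Arg 3)"
| "body Upto =
     Cond (Arg 1) (Pairing (Arg 0) (call Upto [Pairing Empty (Arg 0), Right (Arg 1)])) Empty"
| "body Append =
     Cond (Arg 0) (Pairing (Left (Arg 0)) (call Append [Right (Arg 0), Arg 1])) (Arg 1)"
| "body Take =
     Cond (Arg 0)
       (Cond (Arg 1) (Pairing (Left (Arg 1)) (call Take [Right (Arg 0), Right (Arg 1)])) Empty)
       Empty"
| "body Drop =
     Cond (Arg 0) (call Drop [Right (Arg 0), Right (Arg 1)]) (Arg 1)"

definition program :: prog where
  "program = map body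
     [Solve, Cover, Match, Min_Cut, Cut, Member, Equal, Push, Pop, Upto, Append, Take, Drop]"

lemma index_less_length_program: "index f < length program"
  by (cases f) (simp_all add: program_def)

lemma program_index: "program ! index f = body f"
  by (cases f) (simp_all add: program_def)

declare body.simps [simp del]

lemmas body_simps = body.simps[unfolded Let_def]

text \<open>
  The equations for the weakest precondition \<open>wp\<close> let the simplifier execute a body symbolically up
  to its next call.
\<close>

definition wp :: "btree list \<Rightarrow> expr \<Rightarrow> (btree \<Rightarrow> nat \<Rightarrow> bool) \<Rightarrow> bool" where
  "wp vs e Q \<longleftrightarrow> (\<exists>b t. eval program vs e b t \<and> Q b t)"

definition wps :: "btree list \<Rightarrow> expr list \<Rightarrow> (btree list \<Rightarrow> nat \<Rightarrow> bool) \<Rightarrow> bool" where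
  "wps vs es Q \<longleftrightarrow> (\<exists>bs t. evals program vs es bs t \<and> Q bs t)"

inductive_simps eval_iffs:
  "eval P vs (Arg i) b t"
  "eval P vs Empty b t"
  "eval P vs (Pairing e1 e2) b t"
  "eval P vs (Left e) b t"
  "eval P vs (Right e) b t"
  "eval P vs (Cond e e1 e2) b t"
  "eval P vs (Call f es) b t"

inductive_simps evals_iffs:
  "evals P vs [] bs t"
  "evals P vs (e # es) bs t"

lemma wp_simps [simp]:
  "wp vs (Arg i) Q \<longleftrightarrow> i < length vs \<and> Q (vs ! i) 1"
  "wp vs Empty Q \<longleftrightarrow> Q Leaf 1"
  "wp vs (Pairing e1 e2) Q \<longleftrightarrow> wp vs e1 (\<lambda>a s. wp vs e2 (\<lambda>b t. Q (Node a b) (s + t + 1)))"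
  "wp vs (Left e) Q \<longleftrightarrow> wp vs e (\<lambda>a s. Q (left_of a) (s + 1))"
  "wp vs (Right e) Q \<longleftrightarrow> wp vs e (\<lambda>a s. Q (right_of a) (s + 1))"
  "wp vs (Cond e e1 e2) Q \<longleftrightarrow>
     wp vs e (\<lambda>a s. wp vs (if a = Leaf then e2 else e1) (\<lambda>b t. Q b (s + t + 1)))"
  "wp vs (call f es) Q \<longleftrightarrow> wps vs es (\<lambda>ws s. wp ws (body f) (\<lambda>b t. Q b (s + t + 1)))"
  unfolding wp_def wps_def
  by (simp_all add: eval_iffs call_def index_less_length_program program_index) (blast | fastforce)+

lemma wps_simps [simp]:
  "wps vs [] R \<longleftrightarrow> R [] 0"
  "wps vs (e # es) R \<longleftrightarrow> wp vs e (\<lambda>a s. wps vs es (\<lambda>as t. R (a # as) (s + t)))"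
  unfolding wp_def wps_def by (simp_all add: evals_iffs) blast

definition computes :: "routine \<Rightarrow> btree list \<Rightarrow> btree \<Rightarrow> nat \<Rightarrow> bool" where
  "computes f vs b T \<longleftrightarrow> wp vs (body f) (\<lambda>b' t. b' = b \<and> t \<le> T)"

lemma wp_body:
  assumes "computes f vs b T" "\<And>t. t \<le> T \<Longrightarrow> Q b t"
  shows "wp vs (body f) Q"
  using assms by (auto simp: computes_def wp_def)

lemma computes_mono: "computes f vs b T \<Longrightarrow> T \<le> T' \<Longrightarrow> computes f vs b T'"
  by (auto simp: computes_def wp_def)

fun enc_list :: "('a \<Rightarrow> btree) \<Rightarrow> 'a list \<Rightarrow> btree" where
  "enc_list f [] = Leaf"
| "enc_list f (x # xs) = Node (f x) (enc_list f xs)"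

lemma enc_list_eq_Leaf [simp]: "enc_list f xs = Leaf \<longleftrightarrow> xs = []"
  by (cases xs) auto

lemma enc_nat_eq_Leaf [simp]: "enc_nat n = Leaf \<longleftrightarrow> n = 0"
  by (cases n) auto

lemma enc_nat_eq_enc_list: "enc_nat n = enc_list (\<lambda>_. Leaf) (replicate n ())"
  by (induction n) auto

definition enc_edge :: "nat \<times> nat \<Rightarrow> btree" where
  "enc_edge e = Node (enc_nat (fst e)) (enc_nat (snd e))"

lemma enc_edges_eq_enc_list: "enc_edges es = enc_list enc_edge es"
  by (induction es rule: enc_edges.induct) (auto simp: enc_edge_def)

definition enc_bool :: "bool \<Rightarrow> btree" where
  "enc_bool b = (if b then Node Leaf Leaf else Leaf)"

abbreviation enc_nats :: "nat list \<Rightarrow> btree" where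
  "enc_nats \<equiv> enc_list enc_nat"

lemma right_of_enc_list [simp]: "right_of (enc_list f xs) = enc_list f (tl xs)"
  by (cases xs) auto

lemma computes_Take:
  "computes Take [enc_nat k, enc_list f xs] (enc_list f (take k xs)) (20 * (k + 1))"
proof (induction k arbitrary: xs)
  case 0
  show ?case unfolding computes_def body_simps by simp
next
  case (Suc k)
  show ?case
    unfolding computes_def body_simps by (cases xs; simp) (rule wp_body[OF Suc.IH], simp)
qed

lemma computes_Take_min:
  "computes Take [enc_nat i, enc_nat j] (enc_nat (min i j)) (20 * (i + 1))"
  using computes_Take[of i "\<lambda>_. Leaf" "replicate j ()"] by (simp add: enc_nat_eq_enc_list)

lemma computes_Drop:
  "computes Drop [enc_nat k, enc_list f xs] (enc_list f (drop k xs)) (20 * (k + 1))"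
proof (induction k arbitrary: xs)
  case 0
  show ?case unfolding computes_def body_simps by simp
next
  case (Suc k)
  show ?case
    unfolding computes_def body_simps by (simp add: drop_Suc) (rule wp_body[OF Suc.IH], simp)
qed

lemma computes_Drop_diff:
  "computes Drop [enc_nat i, enc_nat j] (enc_nat (j - i)) (20 * (i + 1))"
  using computes_Drop[of i "\<lambda>_. Leaf" "replicate j ()"] by (simp add: enc_nat_eq_enc_list)

lemma computes_Append:
  "computes Append [enc_list f xs, enc_list f ys] (enc_list f (xs @ ys)) (20 * (length xs + 1))"
proof (induction xs)
  case Nil
  show ?case unfolding computes_def body_simps by simp
next
  case (Cons x xs)
  show ?case unfolding computes_def body_simps by simp (rule wp_body[OF Cons.IH], simp)
qed

lemma computes_Upto: "computes Upto [enc_nat i, enc_nat c] (enc_nats [i..<i + c]) (20 * (c + 1))"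
proof (induction c arbitrary: i)
  case 0
  show ?case unfolding computes_def body_simps by simp
next
  case (Suc c)
  show ?case
    unfolding computes_def body_simps using wp_body[OF Suc.IH[of "Suc i"]]
    by (simp add: upt_conv_Cons del: upt_Suc)
qed

lemma computes_Push:
  "computes Push [enc_nat k, f v, enc_list f st] (enc_list f (replicate k v @ st)) (20 * (k + 1))"
proof (induction k)
  case 0
  show ?case unfolding computes_def body_simps by simp
next
  case (Suc k)
  show ?case unfolding computes_def body_simps by simp (rule wp_body[OF Suc.IH], simp)
qed

lemma computes_Pop:
  "computes Pop [enc_nat k, enc_nat v, enc_nats st, enc_list enc_edge es]
    (enc_list enc_edge (map (\<lambda>q. (q, v)) (take k st) @ es)) (30 * (k + 1))"
proof (induction k arbitrary: st)
  case 0
  show ?case unfolding computes_def body_simps by simp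
next
  case (Suc k)
  show ?case
    unfolding computes_def body_simps
    by (cases st; simp add: enc_edge_def) (rule wp_body[OF Suc.IH], simp)
qed

lemma computes_Equal:
  assumes "i < n" "j < n"
  shows "computes Equal [enc_nat i, enc_nat j] (enc_bool (i = j)) (60 * n)"
  unfolding computes_def body_simps
  using assms by (auto simp: enc_bool_def intro!: wp_body[OF computes_Drop_diff])

lemma computes_length_bound:
  assumes "computes f vs b ((length xs + 1) * T)" "length xs < n"
  shows "computes f vs b (n * T)"
  using assms(1) by (rule computes_mono) (use assms(2) in \<open>intro mult_le_mono1; simp\<close>)

lemma computes_Member:
  assumes "v < n" "set xs \<subseteq> {..<n}" "length xs < n"
  shows "computes Member [enc_nat v, enc_nats xs] (enc_bool (v \<in> set xs)) (80 * n ^ 2)"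
proof -
  have "computes Member [enc_nat v, enc_nats xs] (enc_bool (v \<in> set xs))
      ((length xs + 1) * (80 * n))"
    using assms(2)
  proof (induction xs)
    case Nil
    show ?case unfolding computes_def body_simps using assms(1) by (simp add: enc_bool_def)
  next
    case (Cons x xs)
    have "computes Equal [enc_nat v, enc_nat x] (enc_bool (v = x)) (60 * n)"
      by (rule computes_Equal) (use assms(1) Cons.prems in auto)
    with Cons show ?case
      unfolding computes_def[of Member "[_, enc_nats (x # xs)]"] body.simps using assms(1)
      by (auto simp: enc_bool_def intro!: wp_body)
  qed
  from computes_length_bound[OF this assms(3)] show ?thesis
    by (simp add: power2_eq_square ac_simps)
qed

lemma computes_Cut:
  assumes "demands_on [0..<n] (demands es)" "length es < n" "set xs \<subseteq> {..<n}" "length xs < n"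
  shows "computes Cut [enc_list enc_edge es, enc_nats xs]
    (enc_nat (cut_size (demands es) (set xs))) (200 * n ^ 3)"
proof -
  have pos: "n \<le> n ^ 2" "0 < n" using assms(2) by (simp_all add: self_le_power)
  have "computes Cut [enc_list enc_edge es, enc_nats xs]
    (enc_nat (cut_size (demands es) (set xs))) ((length es + 1) * (200 * n ^ 2))"
    using assms(1)
  proof (induction es)
    case Nil
    show ?case unfolding computes_def body_simps using pos by simp
  next
    case (Cons e es)
    obtain a b where [simp]: "e = (a, b)" by (cases e)
    have ab: "a < n" "b < n" "a \<noteq> b" and on: "demands_on [0..<n] (demands es)"
      using Cons.prems by auto
    note calls = computes_Member[OF ab(1) assms(3,4)] computes_Member[OF ab(2) assms(3,4)]
      Cons.IH[OF on]
    show ?case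
      unfolding computes_def body_simps using pos ab(3)
      by (auto simp: enc_bool_def enc_edge_def card_doubleton_Int intro!: calls[THEN wp_body])
  qed
  from computes_length_bound[OF this assms(2)] show ?thesis
    by (simp add: power2_eq_square power3_eq_cube ac_simps)
qed

context
  fixes n :: nat and es :: "(nat \<times> nat) list"
  assumes on: "demands_on [0..<n] (demands es)" and length_es: "length es < n"
begin

lemma computes_Min_Cut:
  assumes "set (xs @ ys) \<subseteq> {..<n}" "length (xs @ ys) < n"
  shows "computes Min_Cut [enc_list enc_edge es, enc_nats xs, enc_nats ys]
    (enc_nat (min_cut (demands es) (set xs) ys)) (250 * n ^ 4)"
proof -
  have pos: "n \<le> n ^ 3" "0 < n" using length_es by (simp_all add: self_le_power)
  have "computes Min_Cut [enc_list enc_edge es, enc_nats xs, enc_nats ys]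
    (enc_nat (min_cut (demands es) (set xs) ys)) ((length ys + 1) * (250 * n ^ 3))"
    using assms
  proof (induction ys arbitrary: xs)
    case Nil
    show ?case
      unfolding computes_def body_simps using pos Nil
      by (auto intro!: computes_Cut[OF on length_es, THEN wp_body])
  next
    case (Cons y ys)
    have cut: "computes Cut [enc_list enc_edge es, enc_nats xs]
      (enc_nat (cut_size (demands es) (set xs))) (200 * n ^ 3)"
      by (rule computes_Cut[OF on length_es]) (use Cons.prems in auto)
    have IH: "computes Min_Cut [enc_list enc_edge es, enc_nats (y # xs), enc_nats ys]
      (enc_nat (min_cut (demands es) (set (y # xs)) ys)) ((length ys + 1) * (250 * n ^ 3))"
      by (rule Cons.IH) (use Cons.prems in auto)
    note calls = cut IH[simplified] computes_Take_min
    have "cut_size (demands es) (set xs) < n"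
      using cut_size_le_size[of "demands es" "set xs"] length_es by simp
    with pos show ?case
      unfolding computes_def body_simps
      by (auto simp: min_cut_Cons intro!: calls[THEN wp_body])
  qed
  from computes_length_bound[OF this] show ?thesis
    using assms(2) by (simp add: power_numeral_reduce ac_simps)
qed

lemma computes_Match:
  assumes "set (vs @ ys) \<subseteq> {..<n}" "length (vs @ ys) < n"
  defines "h \<equiv> \<lambda>xs. min_cut (demands es) (set xs) ys"
  shows "computes Match [enc_list enc_edge es, enc_nats vs, enc_nats ys, enc_nats st]
    (enc_list enc_edge (height_matching h vs st)) (2000 * n ^ 5)"
proof -
  have pos: "n \<le> n ^ 4" "0 < n" using length_es by (simp_all add: self_le_power)
  have "computes Match [enc_list enc_edge es, enc_nats vs, enc_nats ys, enc_nats st]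
    (enc_list enc_edge (height_matching h vs st)) ((length vs + 1) * (2000 * n ^ 4))"
    using assms(1,2)
  proof (induction vs arbitrary: st)
    case Nil
    show ?case
      unfolding computes_def body_simps using pos by simp
  next
    case (Cons v vs)
    have height: "computes Min_Cut [enc_list enc_edge es, enc_nats xs, enc_nats ys]
        (enc_nat (h xs)) (250 * n ^ 4)"
      if "xs \<in> {v # vs, vs}" for xs
      unfolding h_def by (rule computes_Min_Cut) (use Cons.prems that in auto)
    have IH: "computes Match [enc_list enc_edge es, enc_nats vs, enc_nats ys, enc_nats st]
      (enc_list enc_edge (height_matching h vs st)) ((length vs + 1) * (2000 * n ^ 4))" for st
      by (rule Cons.IH) (use Cons.prems in auto)
    note calls = height[of "v # vs", simplified] height[of vs, simplified] computes_Drop_diff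
      computes_Drop computes_Push computes_Pop IH
    have "h xs < n" for xs
      using min_cut_le_size[of "demands es" "set xs" ys] length_es by (simp add: h_def)
    from this[of "v # vs"] this[of vs] pos show ?case
      unfolding computes_def body_simps by (auto intro!: calls[THEN wp_body])
  qed
  from computes_length_bound[OF this] show ?thesis
    using assms(2) by (simp add: power_numeral_reduce ac_simps)
qed

lemma computes_cut_matching:
  assumes "set (vs @ ys) \<subseteq> {..<n}" "length (vs @ ys) < n"
  shows "computes Match [enc_list enc_edge es, enc_nats vs, enc_nats ys, Leaf]
    (enc_list enc_edge (cut_matching (demands es) vs ys)) (2000 * n ^ 5)"
  using computes_Match[OF assms, of "[]"] by (simp add: cut_matching_def)

lemma computes_Cover:
  assumes "set (ss @ ts) \<subseteq> {..<n}" "length (ss @ ts) < n"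
  shows "computes Cover [enc_list enc_edge es, enc_nats ss, enc_nats ts]
    (Node (enc_list enc_edge (straight_matching (demands es) ss ts))
      (enc_list enc_edge (doubled_matching (demands es) ss ts))) (7000 * n ^ 5)"
proof -
  have straight: "computes Match [enc_list enc_edge es, enc_nats (ss @ ts), Leaf, Leaf]
      (enc_list enc_edge (straight_matching (demands es) ss ts)) (2000 * n ^ 5)"
    unfolding straight_matching_def using computes_cut_matching[of "ss @ ts" "[]"] assms by simp
  note calls = straight computes_cut_matching[OF assms] computes_Append
  have "length (cut_matching (demands es) ss ts) \<le> length ss * length es"
    using length_cut_matching[of "demands es" ss ts] by simp
  also have "\<dots> \<le> n * n"
    using assms(2) length_es by (intro mult_le_mono) auto
  also have "\<dots> \<le> n ^ 5"
    using power_increasing[of 2 5 n] length_es by (simp add: power2_eq_square)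
  finally have "length (cut_matching (demands es) ss ts) \<le> n ^ 5" .
  moreover have "n \<le> n ^ 5" "0 < n" using length_es by (simp_all add: self_le_power)
  ultimately show ?thesis
    unfolding computes_def body_simps doubled_matching_def
    using assms(2) by (auto intro!: calls[THEN wp_body])
qed

lemma computes_Solve:
  assumes "m < c" "k \<le> c" "c < n"
  defines "cyc \<equiv> rotate m [0..<c]"
  shows "computes Solve [Node (enc_nat c) (Node (Node (enc_nat m) (enc_nat k)) (enc_edges es))]
    (Node (enc_edges (straight_matching (demands es) (take k cyc) (drop k cyc)))
      (enc_edges (doubled_matching (demands es) (take k cyc) (drop k cyc)))) (8000 * n ^ 5)"
proof -
  have cyc: "cyc = drop m [0..<c] @ take m [0..<c]"
    using assms(1) by (simp add: cyc_def rotate_drop_take)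
  have "set cyc \<subseteq> {..<n}" "length cyc < n"
    using assms(3) by (auto simp: cyc_def)
  then have cover: "computes Cover
    [enc_list enc_edge es, enc_nats (take k cyc), enc_nats (drop k cyc)]
    (Node (enc_list enc_edge (straight_matching (demands es) (take k cyc) (drop k cyc)))
      (enc_list enc_edge (doubled_matching (demands es) (take k cyc) (drop k cyc)))) (7000 * n ^ 5)"
    by (intro computes_Cover) simp_all
  note calls = cover[unfolded cyc] computes_Take computes_Drop computes_Append
    computes_Upto[of 0, simplified]
  have "n \<le> n ^ 5" "0 < n" using length_es by (simp_all add: self_le_power)
  then show ?thesis
    unfolding computes_def body_simps cyc
    using assms(1-3) by (auto simp: enc_edges_eq_enc_list intro!: calls[THEN wp_body])
qed

end

section \<open>Correctness\<close>

lemma runs_if_computes_Solve: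
  assumes "computes Solve [a] b T"
  shows "\<exists>t \<le> T + 2. runs program a b t"
proof -
  have "wp [a] (call Solve [Arg 0]) (\<lambda>b' t. b' = b \<and> t \<le> T + 2)"
    using wp_body[OF assms] by simp
  then show ?thesis by (auto simp: wp_def runs_def call_def)
qed

lemma size_enc_nat [simp]: "size (enc_nat n) = n"
  by (induction n) auto

lemma length_le_size_enc_edges: "length es \<le> size (enc_edges es)"
  by (induction es rule: enc_edges.induct) auto

lemma size_enc_edges_le: "set es \<subseteq> {..<n} \<times> {..<n} \<Longrightarrow> size (enc_edges es) \<le> length es * (2 * n)"
  by (induction es rule: enc_edges.induct) auto

definition demands_at :: "'v list \<Rightarrow> (nat \<times> nat) list \<Rightarrow> 'v set multiset" where
  "demands_at F es = image_mset ((`) ((!) F)) (demands es)"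

lemma lists_demands_iff:
  "lists_demands F es H \<longleftrightarrow> set es \<subseteq> {..<length F} \<times> {..<length F} \<and> H = demands_at F es"
proof -
  have "demands_at F es = mset (map (\<lambda>(i, j). {F ! i, F ! j}) es)"
    by (induction es) (auto simp: demands_at_def)
  then show ?thesis unfolding lists_demands_def by auto
qed

lemma demands_on_positions:
  assumes "distinct F" "demands_on F D" "lists_demands F es D"
  shows "demands_on [0..<length F] (demands es)"
proof -
  have "D = demands_at F es" "\<forall>e\<in>#demands es. e \<subseteq> set [0..<length F]"
    using assms(3) by (auto simp: lists_demands_iff demands_def)
  moreover have "inj_on ((!) F) (set [0..<length F])"
    using assms(1) by (simp add: inj_on_nth)
  ultimately show ?thesis
    using assms(2) demands_on_map[of "(!) F" "[0..<length F]"]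
    by (simp add: demands_at_def map_nth)
qed

lemma laminar_cover_positions:
  assumes F: "distinct F" and D: "demands_on F D" "\<forall>e\<in>#D. card (e \<inter> (!) F ` set ss) = 1"
    and es: "lists_demands F es D" and cycle: "rotate m [0..<length F] = ss @ ts"
  shows "laminar_cover F D (demands_at F (straight_matching (demands es) ss ts))
    (demands_at F (doubled_matching (demands es) ss ts))"
proof -
  have inj: "inj_on ((!) F) {..<length F}"
    using F by (simp add: inj_on_nth)
  have D_eq: "D = demands_at F es"
    using es by (simp add: lists_demands_iff)
  have on: "demands_on [0..<length F] (demands es)"
    by (rule demands_on_positions[OF F D(1) es])
  have ss: "set ss \<subseteq> {..<length F}"
    using arg_cong[OF cycle, of set] by auto
  have "card (e \<inter> set ss) = 1" if e: "e \<in># demands es" for e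
  proof -
    have "(!) F ` e \<in># D" "e \<subseteq> {..<length F}"
      using e on by (auto simp: D_eq demands_at_def demands_on_def subset_iff)
    then show ?thesis
      using D(2) card_image_Int_image[OF inj _ ss] by metis
  qed
  then have "laminar_cover [0..<length F] (demands es)
      (demands (straight_matching (demands es) ss ts))
      (demands (doubled_matching (demands es) ss ts))"
    by (intro laminar_cover_cycle[OF _ on cycle]) simp_all
  from laminar_cover_map[OF _ on this, of "(!) F"] show ?thesis
    using inj by (simp add: map_nth D_eq demands_at_def atLeast0LessThan)
qed

lemma size_enc_edges_cut_matching:
  assumes "set vs \<subseteq> {..<n}" "length vs \<le> n" "length es \<le> n"
  shows "size (enc_edges (cut_matching (demands es) vs ys)) \<le> 2 * n ^ 3"
proof -
  let ?es = "cut_matching (demands es) vs ys"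
  have "set ?es \<subseteq> {..<n} \<times> {..<n}"
    using assms(1) by (rule cut_matching_subset)
  then have "size (enc_edges ?es) \<le> length ?es * (2 * n)"
    by (rule size_enc_edges_le)
  also have "length ?es \<le> length vs * length es"
    using length_cut_matching[of "demands es" vs ys] by simp
  also have "\<dots> \<le> n * n"
    using assms(2,3) by (rule mult_le_mono)
  finally show ?thesis by (simp add: power3_eq_cube ac_simps)
qed

lemma size_enc_edges_append:
  "size (enc_edges (es @ es')) = size (enc_edges es) + size (enc_edges es')"
  by (induction es rule: enc_edges.induct) auto

lemma size_enc_edges_matchings:
  assumes "set (ss @ ts) \<subseteq> {..<n}" "length (ss @ ts) \<le> n" "length es \<le> n"
  shows "size (enc_edges (straight_matching (demands es) ss ts)) +
    size (enc_edges (doubled_matching (demands es) ss ts)) \<le> 6 * n ^ 3"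
  using size_enc_edges_cut_matching[of "ss @ ts" n es "[]"]
    size_enc_edges_cut_matching[of ss n es ts] assms
  by (simp add: straight_matching_def doubled_matching_def size_enc_edges_append)

lemma encodes_output_matchings:
  assumes "set (ss @ ts) \<subseteq> {..<length F}"
  shows "encodes_output F (demands_at F (straight_matching D ss ts))
    (demands_at F (doubled_matching D ss ts))
    (Node (enc_edges (straight_matching D ss ts)) (enc_edges (doubled_matching D ss ts)))"
  using assms cut_matching_subset[of "ss @ ts" "{..<length F}" D "[]"]
    cut_matching_subset[of ss "{..<length F}" D ts]
  unfolding encodes_output_def lists_demands_iff straight_matching_def doubled_matching_def
  by (intro exI conjI refl) auto

lemma program_correct:
  assumes inst: "segment_instance G F D S" and input: "encodes_input F D S a"
  shows "\<exists>L1 L2 b t. laminar_cover F D L1 L2 \<and> encodes_output F L1 L2 b \<and> runs program a b t \<and>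
    t \<le> 9000 * size a ^ 5 \<and> size b \<le> 9000 * size a ^ 5"
proof -
  have F: "distinct F" and D: "demands_on F D" "\<forall>e\<in>#D. card (e \<inter> S) = 1"
    using inst by (auto simp: segment_instance_def facial_cycle_def)
  obtain m k es where m: "m < length F" and k: "k \<le> length F"
    and S: "S = set (take k (rotate m F))" and es: "lists_demands F es D"
    and a: "a = Node (enc_nat (length F)) (Node (Node (enc_nat m) (enc_nat k)) (enc_edges es))"
    using input unfolding encodes_input_def by blast
  define cyc where "cyc = rotate m [0..<length F]"
  let ?L1 = "straight_matching (demands es) (take k cyc) (drop k cyc)"
    and ?L2 = "doubled_matching (demands es) (take k cyc) (drop k cyc)"
  let ?b = "Node (enc_edges ?L1) (enc_edges ?L2)"
  have cyc: "set (take k cyc @ drop k cyc) = {..<length F}" "length cyc = length F"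
    by (auto simp: cyc_def)
  have "S = (!) F ` set (take k cyc)"
    unfolding S cyc_def by (metis map_nth rotate_map set_map take_map)
  then have cover: "laminar_cover F D (demands_at F ?L1) (demands_at F ?L2)"
    using laminar_cover_positions[OF F D(1) _ es] D(2) by (simp add: cyc_def)
  have n: "length F < size a" "length es < size a" "0 < size a"
    using length_le_size_enc_edges[of es] by (simp_all add: a)
  have "demands_on [0..<size a] (demands es)"
    using demands_on_positions[OF F D(1) es] n(1) by (fastforce simp: demands_on_def)
  then have "computes Solve [a] ?b (8000 * size a ^ 5)"
    using computes_Solve[OF _ n(2) m k n(1)] unfolding cyc_def a by blast
  then obtain t where t: "runs program a ?b t" "t \<le> 8000 * size a ^ 5 + 2"
    using runs_if_computes_Solve by blast
  have "size ?b \<le> 6 * size a ^ 3 + 1"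
    using size_enc_edges_matchings[of "take k cyc" "drop k cyc" "size a" es] cyc n by simp
  moreover have "size a ^ 3 \<le> size a ^ 5" "1 \<le> size a ^ 5"
    using n(3) by (simp_all add: power_increasing)
  ultimately have "t \<le> 9000 * size a ^ 5" "size ?b \<le> 9000 * size a ^ 5"
    using t(2) by linarith+
  moreover have "encodes_output F (demands_at F ?L1) (demands_at F ?L2) ?b"
    using encodes_output_matchings cyc(1) by blast
  ultimately show ?thesis using cover t(1) by blast
qed

theorem theorem3:
  "(\<forall>G F D S. segment_instance G F D S \<longrightarrow> (\<exists>L1 L2. laminar_cover F D L1 L2)) \<and>
   (\<exists>(P :: prog) (p :: nat poly). \<forall>G F D S a.
      segment_instance G F D S \<and> encodes_input F D S a \<longrightarrow>
      (\<exists>L1 L2 b t. laminar_cover F D L1 L2 \<and> encodes_output F L1 L2 b \<and>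
         runs P a b t \<and> t \<le> poly p (size a) \<and> size b \<le> poly p (size a)))"
proof (intro conjI allI impI)
  fix G F D S assume "segment_instance G F D S"
  then obtain m k where "distinct F" "demands_on F D"
    "\<forall>e\<in>#D. card (e \<inter> set (take k (rotate m F))) = 1"
    by (auto simp: segment_instance_def facial_cycle_def contiguous_segment_def)
  then show "\<exists>L1 L2. laminar_cover F D L1 L2"
    using laminar_cover_cycle[of F D m "take k (rotate m F)" "drop k (rotate m F)"] by auto
next
  have "poly (monom 9000 5) n = 9000 * n ^ 5" for n :: nat
    by (rule poly_monom)
  then show "\<exists>(P :: prog) (p :: nat poly). \<forall>G F D S a.
      segment_instance G F D S \<and> encodes_input F D S a \<longrightarrow>
      (\<exists>L1 L2 b t. laminar_cover F D L1 L2 \<and> encodes_output F L1 L2 b \<and>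
         runs P a b t \<and> t \<le> poly p (size a) \<and> size b \<le> poly p (size a))"
    using program_correct by (intro exI[of _ program] exI[of _ "monom 9000 5"]) metis
qed

end
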